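(* Suppose the ellipticity assumption and the unbounded-drift assumption (with data $\bar\Theta$, $m$, $\kappa$) stated in the context hold. Then there exist numbers $\Theta_0\ge\bar\Theta$ and $\bar\nu>0$ (independent of $u$) such that the following holds. If $u\in C^2(U)\cap C(\widetilde U)$ satisfies $Lu\le0$ in $U$ and $u\le0$ on $\gamma$, then there are only two possibilities. (i) One has, for all $\theta\ge\theta_0$, $$\max_{x\in \mathcal S_\theta} u^+(x)\le \Big(\max_{x\in \mathcal S_{\theta_0}} u^+(x)\Big) \min\left\{1,\exp\left( -\bar\nu\int_{\Theta_0}^\theta \kappa^{m(\zeta)}\, d\zeta\right)\right\}$$ (for $\theta<\Theta_0$ the minimum is understood to be $1$). Consequently, $\lim_{\theta\to\infty} \big(\max_{x\in \mathcal S_{\theta}} u^+(x)\big)=0$. (ii) There exists $C>0$ depending on $u$ such that, for sufficiently large $\theta$, $$\max_{x\in \mathcal S_\theta} u^+(x) \ge C \exp\left( \bar\nu\int_{\bar\Theta}^\theta \kappa^{m(\zeta)}\, d\zeta\right).$$ Consequently, $\lim_{\theta\to\infty} \big(\max_{x\in \mathcal S_{\theta}} u^+(x)\big)=\infty$.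
   Context: Domain. Let $X(r,\theta)=(r\cos\theta,r\sin\theta)$ for $r\ge0$, $\theta\in\mathbb R$. Fix $\theta_0\in\mathbb R$ and positive continuous functions $r_1,r_2$ on $[\theta_0,\infty)$ with $r_2(\theta+2\pi)<r_1(\theta)<r_2(\theta)$ for all $\theta\ge\theta_0$, and assume there is $r_*>0$ with $\lim_{\theta\to\infty}r_1(\theta)=\lim_{\theta\to\infty}r_2(\theta)=r_*$. Define $U=\{X(r,\theta):\theta>\theta_0,\ r_1(\theta)<r<r_2(\theta)\}$ (open and bounded), $\widetilde U=\{X(r,\theta):\theta\ge\theta_0,\ r_1(\theta)\le r\le r_2(\theta)\}$, $\gamma=\{X(r_i(\theta),\theta):\theta\ge\theta_0,\ i=1,2\}$, $\mathcal S_\theta=\{X(r,\theta): r_1(\theta)\le r\le r_2(\theta)\}$ for $\theta\ge\theta_0$, and $U_I=\{X(r,\theta):\theta\in I,\ r_1(\theta)<r<r_2(\theta)\}$ for $I\subset[\theta_0,\infty)$. Operator. $A=(a_{ij})$ is a function from $U$ to the real symmetric $2\times2$ matrices, $b:U\to\mathbb R^2$, and $Lu=-\sum_{i,j=1}^2 a_{ij}\frac{\partial^2u}{\partial x_i\partial x_j}+b\cdot\nabla u$ for $u\in C^2(U)$. Ellipticity assumption: there are constants $c_0>0$, $M_1>0$ such that $\xi^{\rm T}A(x)\xi\ge c_0|\xi|^2$ and $\mathrm{Tr}(A(x))\le M_1$ for all $x\in U$, $\xi\in\mathbb R^2$. Unbounded-drift assumption: there are a number $\bar\Theta\ge\theta_0$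 and an increasing function $m:[\bar\Theta,\infty)\to[0,\infty)$ such that $b$ is bounded on $U\cap U_{[\theta_0,\bar\Theta]}$; for any $\theta\ge\bar\Theta$, $|b(x)|\le m(\theta)$ for all $x\in U\cap\mathcal S_\theta$; $\lim_{\theta\to\infty}m(\theta)=\infty$; and there is a number $\kappa\in(0,1)$ with $\int_{\bar\Theta}^\infty\kappa^{m(\theta)}\,d\theta=\infty$. Notation: $u^+=\max\{0,u\}$. "There are only two possibilities" means that at least one of (i), (ii) holds. *)

theory Defs
  imports "HOL-Analysis.Analysis"
begin

section \<open>The spiral domain\<close>

definition polar :: "real \<Rightarrow> real \<Rightarrow> real^2" where
  "polar r \<theta> = vector [r * cos \<theta>, r * sin \<theta>]"

definition spiral_strip :: "(real \<Rightarrow> real) \<Rightarrow> (real \<Rightarrow> real) \<Rightarrow> real set \<Rightarrow> (real^2) set" where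
  "spiral_strip r1 r2 I = {polar r \<theta> | r \<theta>. \<theta> \<in> I \<and> r1 \<theta> < r \<and> r < r2 \<theta>}"

definition spiral :: "real \<Rightarrow> (real \<Rightarrow> real) \<Rightarrow> (real \<Rightarrow> real) \<Rightarrow> (real^2) set" where
  "spiral \<theta>0 r1 r2 = {polar r \<theta> | r \<theta>. \<theta> > \<theta>0 \<and> r1 \<theta> < r \<and> r < r2 \<theta>}"

text \<open>The set written \<open>U\<close> with a tilde; it is not the topological closure of the spiral, as the
  limit circle is not included.\<close>

definition spiral_closed :: "real \<Rightarrow> (real \<Rightarrow> real) \<Rightarrow> (real \<Rightarrow> real) \<Rightarrow> (real^2) set" where
  "spiral_closed \<theta>0 r1 r2 = {polar r \<theta> | r \<theta>. \<theta> \<ge> \<theta>0 \<and> r1 \<theta> \<le> r \<and> r \<le> r2 \<theta>}"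

definition spiral_sides :: "real \<Rightarrow> (real \<Rightarrow> real) \<Rightarrow> (real \<Rightarrow> real) \<Rightarrow> (real^2) set" where
  "spiral_sides \<theta>0 r1 r2 =
     {polar (r1 \<theta>) \<theta> | \<theta>. \<theta> \<ge> \<theta>0} \<union> {polar (r2 \<theta>) \<theta> | \<theta>. \<theta> \<ge> \<theta>0}"

definition spiral_section :: "(real \<Rightarrow> real) \<Rightarrow> (real \<Rightarrow> real) \<Rightarrow> real \<Rightarrow> (real^2) set" where
  "spiral_section r1 r2 \<theta> = {polar r \<theta> | r. r1 \<theta> \<le> r \<and> r \<le> r2 \<theta>}"

section \<open>Functions of class C2 and the operator\<close>

text \<open>All functions are total on the plane; derivatives at points of an open set depend only on
  the values in that set.  For a function differentiable at \<open>x\<close> the following is the usual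
  partial derivative.\<close>

definition pderiv_at :: "2 \<Rightarrow> (real^2 \<Rightarrow> real) \<Rightarrow> real^2 \<Rightarrow> real" where
  "pderiv_at i f x = frechet_derivative f (at x) (axis i 1)"

definition gradient :: "(real^2 \<Rightarrow> real) \<Rightarrow> real^2 \<Rightarrow> real^2" where
  "gradient f x = (\<chi> i. pderiv_at i f x)"

definition C1_on :: "(real^2) set \<Rightarrow> (real^2 \<Rightarrow> real) \<Rightarrow> bool" where
  "C1_on S f \<longleftrightarrow> (\<forall>x\<in>S. f differentiable (at x)) \<and> (\<forall>i. continuous_on S (pderiv_at i f))"

definition C2_on :: "(real^2) set \<Rightarrow> (real^2 \<Rightarrow> real) \<Rightarrow> bool" where
  "C2_on S f \<longleftrightarrow> C1_on S f \<and> (\<forall>i. C1_on S (pderiv_at i f))"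

definition elliptic_op ::
    "(real^2 \<Rightarrow> real^2^2) \<Rightarrow> (real^2 \<Rightarrow> real^2) \<Rightarrow> (real^2 \<Rightarrow> real) \<Rightarrow> real^2 \<Rightarrow> real" where
  "elliptic_op A b u x =
     - (\<Sum>i\<in>UNIV. \<Sum>j\<in>UNIV. A x $ i $ j * pderiv_at i (pderiv_at j u) x) + b x \<bullet> gradient u x"

section \<open>The maximum of the positive part on a section\<close>

text \<open>Written as a supremum; by the lemma below it is a maximum whenever \<open>u\<close> is continuous
  on the section.\<close>

definition section_max :: "(real \<Rightarrow> real) \<Rightarrow> (real \<Rightarrow> real) \<Rightarrow> (real^2 \<Rightarrow> real) \<Rightarrow> real \<Rightarrow> real" where
  "section_max r1 r2 u \<theta> = (SUP x\<in>spiral_section r1 r2 \<theta>. max 0 (u x))"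

lemma section_max_attained:
  assumes "r1 \<theta> \<le> r2 \<theta>" and "continuous_on (spiral_section r1 r2 \<theta>) u"
  shows "\<exists>x\<in>spiral_section r1 r2 \<theta>. section_max r1 r2 u \<theta> = max 0 (u x) \<and>
    (\<forall>y\<in>spiral_section r1 r2 \<theta>. max 0 (u y) \<le> section_max r1 r2 u \<theta>)"
proof -
  let ?S = "spiral_section r1 r2 \<theta>"
  have eq: "?S = (\<lambda>r. r *\<^sub>R polar 1 \<theta>) ` {r1 \<theta>..r2 \<theta>}"
    by (auto simp: spiral_section_def polar_def vec_eq_iff forall_2 image_iff intro!: exI)
  have "compact ?S"
    unfolding eq by (intro compact_continuous_image continuous_intros compact_Icc)
  moreover have "?S \<noteq> {}"
    using assms(1) unfolding eq by auto
  moreover have "continuous_on ?S (\<lambda>x. max 0 (u x))"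
    using assms(2) by (intro continuous_intros)
  ultimately obtain x where x: "x \<in> ?S" "\<And>y. y \<in> ?S \<Longrightarrow> max 0 (u y) \<le> max 0 (u x)"
    using continuous_attains_sup[of ?S "\<lambda>x. max 0 (u x)"] by blast
  have "section_max r1 r2 u \<theta> = max 0 (u x)"
    unfolding section_max_def using x by (intro cSup_eq_maximum) auto
  with x show ?thesis by auto
qed

end

theory Submission
  imports Defs
begin

text \<open>
  Write \<open>M \<theta>\<close> for \<open>section_max r1 r2 u \<theta>\<close>.  On every piece \<open>s < \<theta> < t\<close> of the spiral the drift is bounded, so the
  weak maximum principle holds there.  Since \<open>u \<le> 0\<close> on the sides, it says that \<open>M\<close> is quasi-convex:
  \<open>M \<theta> \<le> max (M s) (M t)\<close> for \<open>s \<le> \<theta> \<le> t\<close> (\<open>section_max_quasiconvex\<close>).  Hence either \<open>M\<close> is nonincreasing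
  on the whole half line, or it rises somewhere and is positive and nondecreasing from then on
  (\<open>quasiconvex_dichotomy\<close>).  These are the two alternatives of the theorem.

  The rates come from a quantitative form of the maximum principle (\<open>window_contraction\<close>): far out on the
  spiral, with \<open>h = pi / 2\<close>,
  \<open>M \<theta> \<le> (1 - c \<kappa> powr m (\<theta> + h)) max (M (\<theta> - h)) (M (\<theta> + h))\<close> for a constant \<open>c > 0\<close> that does not depend
  on \<open>u\<close>.  The comparison function is a Gaussian \<open>exp (- \<alpha> \<bar>x - z\<bar>\<^sup>2)\<close> centred inside the limit circle,
  on the ray of angle \<open>\<theta>\<close>.  It is a strict subsolution once \<open>\<alpha>\<close> is a suitable multiple of the
  drift bound, and because the spiral becomes thin the gain degenerates no faster than any prescribed
  exponential of the drift, in particular no faster than \<open>\<kappa>\<close> to the power of the drift.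

  When \<open>M\<close> is nonincreasing the maximum is \<open>M (\<theta> - h)\<close>, when it is nondecreasing the maximum is \<open>M (\<theta> + h)\<close>.
  Iterating in steps of \<open>h\<close> turns the products of the factors into exponentials of
  \<open>c / h\<close> times the integral of \<open>\<kappa> powr m\<close> (\<open>decay_of_contraction\<close>, \<open>growth_of_contraction\<close>), because \<open>\<kappa> powr m\<close>
  is nonincreasing.  The divergence of this integral gives the two limits.
\<close>

section \<open>A Gaussian barrier at a local maximum\<close>

lemma has_derivative_along_line:
  fixes f :: "real^2 \<Rightarrow> real"
  assumes "f differentiable at (x + t *\<^sub>R \<xi>)"
  shows "((\<lambda>t. f (x + t *\<^sub>R \<xi>)) has_real_derivative (\<Sum>i\<in>UNIV. \<xi> $ i * pderiv_at i f (x + t *\<^sub>R \<xi>))) (at t)"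
proof -
  let ?D = "frechet_derivative f (at (x + t *\<^sub>R \<xi>))"
  have D: "(f has_derivative ?D) (at (x + t *\<^sub>R \<xi>))"
    using assms by (simp add: frechet_derivative_works)
  have "((\<lambda>t. x + t *\<^sub>R \<xi>) has_derivative (\<lambda>h. h *\<^sub>R \<xi>)) (at t)"
    by (auto intro!: derivative_eq_intros)
  from diff_chain_at[OF this D]
  have "((\<lambda>t. f (x + t *\<^sub>R \<xi>)) has_derivative (\<lambda>h. ?D (h *\<^sub>R \<xi>))) (at t)"
    by (simp add: o_def)
  moreover have "?D (h *\<^sub>R \<xi>) = (\<Sum>i\<in>UNIV. \<xi> $ i * pderiv_at i f (x + t *\<^sub>R \<xi>)) * h" for h
  proof -
    interpret D: bounded_linear ?D using D by (rule has_derivative_bounded_linear)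
    have "?D (h *\<^sub>R \<xi>) = h * ?D (\<Sum>i\<in>UNIV. \<xi> $ i *\<^sub>R axis i 1)"
      by (simp add: D.scaleR basis_expansion[of \<xi>, unfolded scalar_mult_eq_scaleR])
    also have "\<dots> = (\<Sum>i\<in>UNIV. \<xi> $ i * pderiv_at i f (x + t *\<^sub>R \<xi>)) * h"
      by (simp add: D.sum D.scaleR pderiv_at_def mult.commute)
    finally show ?thesis .
  qed
  ultimately show ?thesis
    by (simp add: has_field_derivative_def fun_eq_iff)
qed

lemma local_max_derivatives:
  fixes g g' :: "real \<Rightarrow> real"
  assumes g: "\<forall>\<^sub>F t in nhds 0. (g has_real_derivative g' t) (at t)"
    and g': "(g' has_real_derivative D) (at 0)"
    and max: "\<forall>\<^sub>F t in nhds 0. g t \<le> g 0"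
  shows "g' 0 = 0" "D \<le> 0"
proof -
  obtain e where e: "e > 0" "\<And>t. \<bar>t\<bar> < e \<Longrightarrow> (g has_real_derivative g' t) (at t)"
    "\<And>t. \<bar>t\<bar> < e \<Longrightarrow> g t \<le> g 0"
    using eventually_conj[OF g max] by (auto simp: eventually_nhds_metric dist_real_def)
  show "g' 0 = 0"
    using e by (intro DERIV_local_max[of g "g' 0" 0 e]) auto
  then show "D \<le> 0"
  proof (rule_tac ccontr)
    assume "\<not> D \<le> 0" "g' 0 = 0"
    with DERIV_pos_inc_right[OF g'] obtain d
      where d: "d > 0" "\<And>h. 0 < h \<Longrightarrow> h < d \<Longrightarrow> 0 < g' h" by auto
    define h where "h = min d e / 2"
    have h: "0 < h" "h < d" "h < e" using d e by (auto simp: h_def min_def)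
    obtain w where "0 < w" "w < h" "g h - g 0 = (h - 0) * g' w"
      using MVT2[of 0 h g g'] h e(2) by auto
    with d(2)[of w] h have "g h > g 0" by (simp add: algebra_simps)
    with e(3)[of h] h show False by simp
  qed
qed

text \<open>With \<open>a > 0\<close> and nonnegative determinant, the symmetric matrix with entries \<open>a\<close>, \<open>\<beta>\<close>, \<open>\<beta>\<close>, \<open>d\<close>
  equals \<open>(1/a) w w\<^sup>T + (d - \<beta>\<^sup>2/a) e\<^sub>2 e\<^sub>2\<^sup>T\<close> with \<open>w = (a, \<beta>)\<close>.  Its contraction with a Hessian is therefore a
  nonnegative combination of the values of the quadratic form at \<open>w\<close> and at \<open>e\<^sub>2\<close>.  Here \<open>q\<close> is the
  sum of the two mixed second derivatives.\<close>

lemma elliptic_contraction_nonpos: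
  fixes a \<beta> d p q r :: real
  assumes "0 < a" "\<beta>\<^sup>2 \<le> a * d" and neg: "\<And>x y. p * x\<^sup>2 + q * x * y + r * y\<^sup>2 \<le> 0"
  shows "a * p + \<beta> * q + d * r \<le> 0"
proof -
  have "r \<le> 0" using neg[of 0 1] by simp
  then have "(a * d - \<beta>\<^sup>2) * r \<le> 0"
    using assms(2) by (intro mult_nonneg_nonpos) auto
  moreover have "p * a\<^sup>2 + q * a * \<beta> + r * \<beta>\<^sup>2 \<le> 0" by (rule neg)
  ultimately have "a * (a * p + \<beta> * q + d * r) \<le> 0"
    by (simp add: algebra_simps power2_eq_square)
  with assms(1) show ?thesis by (simp add: mult_le_0_iff)
qed

definition gauss :: "real \<Rightarrow> real^2 \<Rightarrow> real^2 \<Rightarrow> real" where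
  "gauss \<alpha> z x = exp (- \<alpha> * (norm (x - z))\<^sup>2)"

lemma gauss_along_line:
  fixes x z \<xi> :: "real^2"
  shows "((\<lambda>t. gauss \<alpha> z (x + t *\<^sub>R \<xi>)) has_real_derivative
      - 2 * \<alpha> * ((x + t *\<^sub>R \<xi> - z) \<bullet> \<xi>) * gauss \<alpha> z (x + t *\<^sub>R \<xi>)) (at t)"
proof -
  have "(norm (x + t *\<^sub>R \<xi> - z))\<^sup>2
      = (x - z) \<bullet> (x - z) + 2 * t * ((x - z) \<bullet> \<xi>) + t\<^sup>2 * (\<xi> \<bullet> \<xi>)" for t
    unfolding power2_norm_eq_inner
    by (simp add: inner_diff_left inner_diff_right inner_add_left inner_add_right
        inner_commute power2_eq_square algebra_simps)
  then have *: "gauss \<alpha> z (x + t *\<^sub>R \<xi>) =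
      exp (- \<alpha> * ((x - z) \<bullet> (x - z) + 2 * t * ((x - z) \<bullet> \<xi>) + t\<^sup>2 * (\<xi> \<bullet> \<xi>)))" for t
    by (simp add: gauss_def)
  show ?thesis unfolding *
    by (auto intro!: derivative_eq_intros simp: inner_diff_left inner_add_left algebra_simps)
qed

lemma gauss_along_line_2:
  fixes x z \<xi> :: "real^2"
  shows "((\<lambda>t. - 2 * \<alpha> * ((x + t *\<^sub>R \<xi> - z) \<bullet> \<xi>) * gauss \<alpha> z (x + t *\<^sub>R \<xi>)) has_real_derivative
      (4 * \<alpha>\<^sup>2 * ((x - z) \<bullet> \<xi>)\<^sup>2 - 2 * \<alpha> * (\<xi> \<bullet> \<xi>)) * gauss \<alpha> z x) (at 0)"
proof -
  have "((\<lambda>t. - 2 * \<alpha> * ((x + t *\<^sub>R \<xi> - z) \<bullet> \<xi>)) has_real_derivative - 2 * \<alpha> * (\<xi> \<bullet> \<xi>)) (at 0)"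
    by (auto intro!: derivative_eq_intros simp: inner_diff_left inner_add_left algebra_simps)
  from DERIV_mult[OF this gauss_along_line[of \<alpha> z x \<xi> 0]] show ?thesis
    by (simp add: algebra_simps power2_eq_square)
qed

text \<open>Apart from the positive factor \<open>2 \<alpha> gauss \<alpha> z x\<close>, the operator sends \<open>gauss \<alpha> z\<close> to
  \<open>- 2 \<alpha> y\<^sup>T A y + Tr A - b \<bullet> y\<close> with \<open>y = x - z\<close>.  The condition on \<open>\<alpha>\<close> makes this negative as soon
  as \<open>\<bar>y\<bar> \<ge> \<rho>\<close>: the quadratic term beats the trace and the drift at distance \<open>\<rho>\<close> and grows fastest in
  \<open>\<bar>y\<bar>\<close>.  At a local maximum of \<open>u + k gauss\<close> the operator applied to the sum is nonnegative,
  hence it is positive on \<open>u\<close>.\<close>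

lemma elliptic_op_pos_at_barrier_max:
  fixes u :: "real^2 \<Rightarrow> real" and x z :: "real^2"
  assumes diff: "\<forall>\<^sub>F y in nhds x. u differentiable at y"
    and diff2: "\<And>j. pderiv_at j u differentiable at x"
    and sym: "transpose (A x) = A x"
    and ell: "\<And>\<xi>. \<xi> \<bullet> (A x *v \<xi>) \<ge> c0 * (norm \<xi>)\<^sup>2" and c0: "0 < c0"
    and tr: "trace (A x) \<le> M1" and M1: "0 \<le> M1"
    and B: "norm (b x) \<le> B"
    and \<rho>: "0 < \<rho>" "\<rho> \<le> norm (x - z)"
    and \<alpha>: "M1 + B * \<rho> < 2 * \<alpha> * c0 * \<rho>\<^sup>2"
    and k: "0 < k"
    and max: "\<forall>\<^sub>F y in nhds x. u y + k * gauss \<alpha> z y \<le> u x + k * gauss \<alpha> z x"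
  shows "0 < elliptic_op A b u x"
proof -
  define y where "y = x - z"
  define e where "e = gauss \<alpha> z x"
  define H where "H i j = pderiv_at i (pderiv_at j u) x" for i j
  have e: "e > 0" by (simp add: e_def gauss_def)
  have B0: "0 \<le> B" using B norm_ge_zero[of "b x"] by linarith
  have "0 < 2 * \<alpha> * c0 * \<rho>\<^sup>2"
    using \<alpha> M1 B0 \<rho> mult_nonneg_nonneg[of B \<rho>] by linarith
  then have \<alpha>0: "0 < \<alpha>" using c0 \<rho> by (simp add: zero_less_mult_iff)
  have lines: "(\<Sum>i\<in>UNIV. \<xi> $ i * pderiv_at i u x) - 2 * \<alpha> * k * e * (y \<bullet> \<xi>) = 0"
    "(\<Sum>j\<in>UNIV. \<Sum>i\<in>UNIV. \<xi> $ j * (\<xi> $ i * H i j))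
       + k * e * (4 * \<alpha>\<^sup>2 * (y \<bullet> \<xi>)\<^sup>2 - 2 * \<alpha> * (\<xi> \<bullet> \<xi>)) \<le> 0" for \<xi>
  proof -
    define l where "l t = x + t *\<^sub>R \<xi>" for t :: real
    have l: "filterlim l (nhds x) (nhds 0)"
    proof -
      have "isCont l 0" unfolding l_def by (intro continuous_intros)
      then have "(l \<longlongrightarrow> l 0) (nhds 0)" by (simp add: tendsto_nhds_iff isCont_def)
      then show ?thesis by (simp add: l_def)
    qed
    define g where "g t = u (l t) + k * gauss \<alpha> z (l t)" for t
    define g' where "g' t = (\<Sum>i\<in>UNIV. \<xi> $ i * pderiv_at i u (l t))
        + k * (- 2 * \<alpha> * ((l t - z) \<bullet> \<xi>) * gauss \<alpha> z (l t))" for t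
    have 1: "\<forall>\<^sub>F t in nhds 0. (g has_real_derivative g' t) (at t)"
    proof (rule eventually_mono[OF filterlim_iff[THEN iffD1, OF l, rule_format, OF diff]])
      fix t assume "u differentiable at (l t)"
      then show "(g has_real_derivative g' t) (at t)"
        unfolding g_def g'_def l_def
        by (intro DERIV_add DERIV_cmult has_derivative_along_line gauss_along_line)
    qed
    have 2: "(g' has_real_derivative (\<Sum>j\<in>UNIV. \<xi> $ j * (\<Sum>i\<in>UNIV. \<xi> $ i * H i j))
        + k * ((4 * \<alpha>\<^sup>2 * (y \<bullet> \<xi>)\<^sup>2 - 2 * \<alpha> * (\<xi> \<bullet> \<xi>)) * e)) (at 0)"
    proof -
      have "((\<lambda>t. pderiv_at j u (x + t *\<^sub>R \<xi>)) has_real_derivative (\<Sum>i\<in>UNIV. \<xi> $ i * H i j)) (at 0)" for j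
        using has_derivative_along_line[of "pderiv_at j u" x 0 \<xi>] diff2[of j] by (simp add: H_def)
      then show ?thesis
        unfolding g'_def l_def y_def e_def
        by (intro DERIV_add DERIV_cmult DERIV_sum gauss_along_line_2)
    qed
    have 3: "\<forall>\<^sub>F t in nhds 0. g t \<le> g 0"
      using filterlim_iff[THEN iffD1, OF l, rule_format, OF max]
      by eventually_elim (simp add: g_def l_def)
    note r = local_max_derivatives[OF 1 2 3]
    show "(\<Sum>i\<in>UNIV. \<xi> $ i * pderiv_at i u x) - 2 * \<alpha> * k * e * (y \<bullet> \<xi>) = 0"
      using r(1) by (simp add: g'_def l_def e_def y_def algebra_simps)
    show "(\<Sum>j\<in>UNIV. \<Sum>i\<in>UNIV. \<xi> $ j * (\<xi> $ i * H i j))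
       + k * e * (4 * \<alpha>\<^sup>2 * (y \<bullet> \<xi>)\<^sup>2 - 2 * \<alpha> * (\<xi> \<bullet> \<xi>)) \<le> 0"
      using r(2) by (simp add: sum_distrib_left mult_ac)
  qed
  \<comment> \<open>The first-order conditions along the two axes determine the gradient of \<open>u\<close>.\<close>
  have grad: "gradient u x = (2 * \<alpha> * k * e) *\<^sub>R y"
  proof -
    have "pderiv_at i u x = 2 * \<alpha> * k * e * y $ i" for i
    proof -
      have "(\<Sum>j\<in>UNIV. axis i 1 $ j * pderiv_at j u x) = pderiv_at i u x"
        by (simp add: axis_def if_distrib[of "\<lambda>c. c * _"] cong: if_cong)
      then show ?thesis using lines(1)[of "axis i 1"] by (simp add: inner_axis)
    qed
    then show ?thesis by (simp add: gradient_def vec_eq_iff)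
  qed
  define a \<beta> d where "a = A x $ 1 $ 1" and "\<beta> = A x $ 1 $ 2" and "d = A x $ 2 $ 2"
  have \<beta>': "A x $ 2 $ 1 = \<beta>"
    using sym by (simp add: vec_eq_iff transpose_def \<beta>_def)
  have form: "\<xi> \<bullet> (A x *v \<xi>) = a * (\<xi>$1)\<^sup>2 + 2 * \<beta> * \<xi>$1 * \<xi>$2 + d * (\<xi>$2)\<^sup>2" for \<xi>
    by (simp add: inner_vec_def matrix_vector_mult_def sum_2 a_def d_def \<beta>' flip: \<beta>_def)
       (simp add: power2_eq_square algebra_simps)
  have norm2: "(norm \<xi>)\<^sup>2 = (\<xi>$1)\<^sup>2 + (\<xi>$2)\<^sup>2" for \<xi> :: "real^2"
    unfolding power2_norm_eq_inner by (simp add: inner_vec_def sum_2 power2_eq_square)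
  have a: "0 < a"
    using ell[of "vector [1, 0]"] c0 by (simp add: form norm2)
  \<comment> \<open>The form of \<open>A\<close> takes the value \<open>a (a d - \<beta>\<^sup>2)\<close> at \<open>(- \<beta>, a)\<close>.\<close>
  have det: "\<beta>\<^sup>2 \<le> a * d"
  proof -
    have "0 \<le> c0 * (norm (vector [- \<beta>, a] :: real^2))\<^sup>2" using c0 by simp
    also have "\<dots> \<le> a * (a * d - \<beta>\<^sup>2)"
      using ell[of "vector [- \<beta>, a]"] by (simp add: form power2_eq_square algebra_simps)
    finally show ?thesis using a by (simp add: zero_le_mult_iff)
  qed
  \<comment> \<open>The entries of the Hessian of \<open>u + k gauss\<close>, the two mixed ones added up.\<close>
  define p q r where "p = H 1 1 + k * e * (4 * \<alpha>\<^sup>2 * (y$1)\<^sup>2 - 2 * \<alpha>)"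
    and "q = H 1 2 + H 2 1 + k * e * (8 * \<alpha>\<^sup>2 * y$1 * y$2)"
    and "r = H 2 2 + k * e * (4 * \<alpha>\<^sup>2 * (y$2)\<^sup>2 - 2 * \<alpha>)"
  have "p * s\<^sup>2 + q * s * t + r * t\<^sup>2 \<le> 0" for s t
    using lines(2)[of "vector [s, t]"]
    by (simp add: sum_2 inner_vec_def p_def q_def r_def power2_eq_square algebra_simps)
  from elliptic_contraction_nonpos[OF a det this]
  have "a * H 1 1 + \<beta> * (H 1 2 + H 2 1) + d * H 2 2
      + k * e * (4 * \<alpha>\<^sup>2 * (y \<bullet> (A x *v y)) - 2 * \<alpha> * (a + d)) \<le> 0"
    by (simp add: p_def q_def r_def form power2_eq_square algebra_simps)
  moreover have "elliptic_op A b u x = - (a * H 1 1 + \<beta> * (H 1 2 + H 2 1) + d * H 2 2)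
      + 2 * \<alpha> * k * e * (b x \<bullet> y)"
    by (simp add: elliptic_op_def sum_2 grad \<beta>' a_def d_def flip: \<beta>_def H_def)
       (simp add: algebra_simps)
  ultimately have "elliptic_op A b u x
      \<ge> 2 * \<alpha> * k * e * (2 * \<alpha> * (y \<bullet> (A x *v y)) - (a + d) + b x \<bullet> y)"
    by (simp add: power2_eq_square algebra_simps)
  moreover have "2 * \<alpha> * (y \<bullet> (A x *v y)) - (a + d) + b x \<bullet> y > 0"
  proof -
    define s where "s = norm y"
    have s: "\<rho> \<le> s" "0 < s" using \<rho> by (auto simp: s_def y_def)
    have "- (b x \<bullet> y) \<le> norm (b x) * s"
      using Cauchy_Schwarz_ineq2[of "b x" y] by (simp add: s_def)
    also have "\<dots> \<le> B * s" using B s by (intro mult_right_mono) auto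
    finally have 1: "- (b x \<bullet> y) \<le> B * s" .
    have 2: "2 * \<alpha> * (c0 * s\<^sup>2) \<le> 2 * \<alpha> * (y \<bullet> (A x *v y))"
      using ell[of y] \<alpha>0 by (simp add: s_def)
    have 3: "a + d \<le> M1" using tr by (simp add: trace_def sum_2 a_def d_def)
    have "M1 * \<rho>\<^sup>2 \<le> M1 * s\<^sup>2" "(B * \<rho>) * (\<rho> * s) \<le> (B * \<rho>) * (s * s)"
      using s \<rho> M1 B0 by (auto intro!: mult_left_mono power_mono mult_right_mono)
    then have "(M1 + B * s) * \<rho>\<^sup>2 \<le> (M1 + B * \<rho>) * s\<^sup>2"
      by (simp add: power2_eq_square algebra_simps)
    also have "\<dots> < (2 * \<alpha> * c0 * \<rho>\<^sup>2) * s\<^sup>2"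
      using \<alpha> s by (intro mult_strict_right_mono) auto
    finally have "(M1 + B * s) * \<rho>\<^sup>2 < (2 * \<alpha> * (c0 * s\<^sup>2)) * \<rho>\<^sup>2"
      by (simp add: mult_ac)
    then have "M1 + B * s < 2 * \<alpha> * (c0 * s\<^sup>2)"
      by (rule mult_right_less_imp_less) simp
    then show ?thesis using 1 2 3 by linarith
  qed
  ultimately show ?thesis
    using e k \<alpha>0 by (smt (verit) mult_pos_pos)
qed

section \<open>Geometry of the spiral\<close>

lemma norm_polar: "norm (polar r \<theta>) = \<bar>r\<bar>"
proof -
  have "(norm (polar r \<theta>))\<^sup>2 = r\<^sup>2 * ((sin \<theta>)\<^sup>2 + (cos \<theta>)\<^sup>2)"
    unfolding power2_norm_eq_inner
    by (simp add: inner_vec_def sum_2 polar_def power2_eq_square algebra_simps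
        del: sin_cos_squared_add sin_cos_squared_add3)
  then have "(norm (polar r \<theta>))\<^sup>2 = \<bar>r\<bar>\<^sup>2" by simp
  then show ?thesis by (rule power2_eq_imp_eq) auto
qed

lemma norm_polar_diff:
  "(norm (polar r \<theta> - polar q \<eta>))\<^sup>2 = r\<^sup>2 + q\<^sup>2 - 2 * r * q * cos (\<theta> - \<eta>)"
proof -
  have "(norm (polar r \<theta> - polar q \<eta>))\<^sup>2
      = (norm (polar r \<theta>))\<^sup>2 + (norm (polar q \<eta>))\<^sup>2 - 2 * (polar r \<theta> \<bullet> polar q \<eta>)"
    unfolding power2_norm_eq_inner by (simp add: inner_diff_left inner_diff_right inner_commute)
  moreover have "polar r \<theta> \<bullet> polar q \<eta> = r * q * cos (\<theta> - \<eta>)"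
    by (simp add: inner_vec_def sum_2 polar_def cos_diff algebra_simps)
  ultimately show ?thesis by (simp add: norm_polar)
qed

text \<open>Polar coordinates are continuous near any point other than the origin, so the strips below are
  open.  After rotation by \<open>- \<theta>\<close> the point \<open>x\<close> has coordinates \<open>(c x, s x)\<close> with \<open>c x > 0\<close> nearby, and
  \<open>arctan (s x / c x)\<close> is the increment of the angle.\<close>

lemma polar_chart:
  assumes "0 < r0"
  obtains \<rho> \<tau> :: "real^2 \<Rightarrow> real"
  where "(\<rho> \<longlongrightarrow> r0) (nhds (polar r0 \<theta>))" "(\<tau> \<longlongrightarrow> \<theta>) (nhds (polar r0 \<theta>))"
    "\<forall>\<^sub>F x in nhds (polar r0 \<theta>). x = polar (\<rho> x) (\<tau> x)"
proof -
  define c s where "c x = x$1 * cos \<theta> + x$2 * sin \<theta>" and "s x = x$2 * cos \<theta> - x$1 * sin \<theta>"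
    for x :: "real^2"
  define \<rho> \<tau> where "\<rho> x = norm x" and "\<tau> x = \<theta> + arctan (s x / c x)" for x :: "real^2"
  let ?x = "polar r0 \<theta>"
  have c0: "c ?x = r0"
  proof -
    have "c ?x = r0 * ((sin \<theta>)\<^sup>2 + (cos \<theta>)\<^sup>2)"
      by (simp add: c_def polar_def algebra_simps power2_eq_square
          del: sin_cos_squared_add sin_cos_squared_add3)
    then show ?thesis by simp
  qed
  have s0: "s ?x = 0" by (simp add: s_def polar_def)
  have norm2: "(norm x)\<^sup>2 = (c x)\<^sup>2 + (s x)\<^sup>2" for x
  proof -
    have "(c x)\<^sup>2 + (s x)\<^sup>2 = ((x$1)\<^sup>2 + (x$2)\<^sup>2) * ((sin \<theta>)\<^sup>2 + (cos \<theta>)\<^sup>2)"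
      by (simp add: c_def s_def power2_eq_square algebra_simps
          del: sin_cos_squared_add sin_cos_squared_add3)
    also have "\<dots> = (x$1)\<^sup>2 + (x$2)\<^sup>2" by simp
    also have "\<dots> = (norm x)\<^sup>2"
      unfolding power2_norm_eq_inner by (simp add: inner_vec_def sum_2 power2_eq_square)
    finally show ?thesis by simp
  qed
  have n0: "norm ?x = r0"
    using norm2[of ?x] assms by (simp add: c0 s0)
  have tc: "(c \<longlongrightarrow> c ?x) (nhds ?x)" and ts: "(s \<longlongrightarrow> s ?x) (nhds ?x)"
    unfolding c_def s_def by (auto intro!: tendsto_intros filterlim_ident)
  have "(\<rho> \<longlongrightarrow> \<rho> ?x) (nhds ?x)"
    unfolding \<rho>_def by (intro tendsto_intros filterlim_ident)
  then have "(\<rho> \<longlongrightarrow> r0) (nhds ?x)" by (simp add: \<rho>_def[of ?x] n0)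
  moreover have "(\<tau> \<longlongrightarrow> \<theta> + arctan (s ?x / c ?x)) (nhds ?x)"
    unfolding \<tau>_def using c0 assms by (intro tendsto_intros tc ts) auto
  then have "(\<tau> \<longlongrightarrow> \<theta>) (nhds ?x)" by (simp add: s0)
  moreover have "\<forall>\<^sub>F x in nhds ?x. 0 < c x"
    using order_tendstoD(1)[OF tc, of 0] c0 assms by simp
  then have "\<forall>\<^sub>F x in nhds ?x. x = polar (\<rho> x) (\<tau> x)"
  proof eventually_elim
    case (elim x)
    have "sqrt (1 + (s x / c x)\<^sup>2) = norm x / c x"
    proof -
      have "1 + (s x / c x)\<^sup>2 = (norm x / c x)\<^sup>2"
        using elim by (simp add: norm2 power_divide field_simps)
      then show ?thesis using elim by simp
    qed
    moreover have "norm x \<noteq> 0" using norm2[of x] elim by (auto simp: power2_eq_square)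
    ultimately have cs: "norm x * cos (arctan (s x / c x)) = c x" "norm x * sin (arctan (s x / c x)) = s x"
      using elim by (simp_all add: cos_arctan sin_arctan)
    have "norm x * cos (\<tau> x) = cos \<theta> * (norm x * cos (arctan (s x / c x)))
        - sin \<theta> * (norm x * sin (arctan (s x / c x)))"
      "norm x * sin (\<tau> x) = sin \<theta> * (norm x * cos (arctan (s x / c x)))
        + cos \<theta> * (norm x * sin (arctan (s x / c x)))"
      by (simp_all add: \<tau>_def cos_add sin_add algebra_simps)
    then have *: "norm x * cos (\<tau> x) = cos \<theta> * c x - sin \<theta> * s x"
      "norm x * sin (\<tau> x) = sin \<theta> * c x + cos \<theta> * s x"
      unfolding cs .
    have "cos \<theta> * c x - sin \<theta> * s x = x$1 * ((sin \<theta>)\<^sup>2 + (cos \<theta>)\<^sup>2)"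
      "sin \<theta> * c x + cos \<theta> * s x = x$2 * ((sin \<theta>)\<^sup>2 + (cos \<theta>)\<^sup>2)"
      by (simp_all add: c_def s_def algebra_simps power2_eq_square
          del: sin_cos_squared_add sin_cos_squared_add3)
    with * show ?case by (simp add: polar_def vec_eq_iff forall_2 \<rho>_def)
  qed
  ultimately show ?thesis by (rule that)
qed

locale spiral_domain =
  fixes \<theta>0 :: real and r1 r2 :: "real \<Rightarrow> real"
  assumes r1_cont: "continuous_on {\<theta>0..} r1"
    and r2_cont: "continuous_on {\<theta>0..} r2"
    and r1_pos: "\<theta>0 \<le> \<theta> \<Longrightarrow> 0 < r1 \<theta>"
    and r1_less_r2: "\<theta>0 \<le> \<theta> \<Longrightarrow> r1 \<theta> < r2 \<theta>"
begin

lemma open_spiral_strip: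
  assumes "\<theta>0 \<le> s"
  shows "open (spiral_strip r1 r2 {s<..<t})"
  unfolding open_subopen[of "spiral_strip r1 r2 {s<..<t}"]
proof
  fix x assume "x \<in> spiral_strip r1 r2 {s<..<t}"
  then obtain r \<theta> where x: "x = polar r \<theta>" "s < \<theta>" "\<theta> < t" "r1 \<theta> < r" "r < r2 \<theta>"
    by (auto simp: spiral_strip_def)
  have "0 < r" using r1_pos[of \<theta>] x assms by simp
  then obtain \<rho> \<tau> where \<rho>: "(\<rho> \<longlongrightarrow> r) (nhds x)" and \<tau>: "(\<tau> \<longlongrightarrow> \<theta>) (nhds x)"
    and chart: "\<forall>\<^sub>F y in nhds x. y = polar (\<rho> y) (\<tau> y)"
    using polar_chart[of r \<theta>] unfolding x(1) by metis
  have int: "\<theta> \<in> interior {\<theta>0..}" using x assms by simp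
  have r: "((\<lambda>y. \<rho> y - r1 (\<tau> y)) \<longlongrightarrow> r - r1 \<theta>) (nhds x)"
    "((\<lambda>y. r2 (\<tau> y) - \<rho> y) \<longlongrightarrow> r2 \<theta> - r) (nhds x)"
    by (intro tendsto_diff \<rho> isCont_tendsto_compose[OF _ \<tau>]
        continuous_on_interior[OF r1_cont int] continuous_on_interior[OF r2_cont int])+
  have "\<forall>\<^sub>F y in nhds x. y \<in> spiral_strip r1 r2 {s<..<t}"
    using chart order_tendstoD(1)[OF \<tau> x(2)] order_tendstoD(2)[OF \<tau> x(3)]
      order_tendstoD(1)[OF r(1), of 0, simplified, OF x(4)]
      order_tendstoD(1)[OF r(2), of 0, simplified, OF x(5)]
  proof eventually_elim
    case (elim y)
    then show ?case unfolding spiral_strip_def by fastforce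
  qed
  then show "\<exists>T. open T \<and> x \<in> T \<and> T \<subseteq> spiral_strip r1 r2 {s<..<t}"
    by (auto simp: eventually_nhds)
qed

lemma strip_subset_spiral:
  assumes "\<theta>0 \<le> s"
  shows "spiral_strip r1 r2 {s<..<t} \<subseteq> spiral \<theta>0 r1 r2"
  using assms by (fastforce simp: spiral_strip_def spiral_def)

definition closed_strip :: "real \<Rightarrow> real \<Rightarrow> (real^2) set" where
  "closed_strip s t = {polar r \<theta> | r \<theta>. s \<le> \<theta> \<and> \<theta> \<le> t \<and> r1 \<theta> \<le> r \<and> r \<le> r2 \<theta>}"

lemma compact_closed_strip:
  assumes "\<theta>0 \<le> s"
  shows "compact (closed_strip s t)"
proof -
  \<comment> \<open>The strip is a continuous image of a rectangle; the second coordinate is the relative position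
    between the two sides.\<close>
  define F where "F p = polar (r1 (fst p) + snd p * (r2 (fst p) - r1 (fst p))) (fst p)"
    for p :: "real \<times> real"
  have "closed_strip s t = F ` ({s..t} \<times> {0..1})"
  proof (intro set_eqI iffI)
    fix x assume "x \<in> closed_strip s t"
    then obtain r \<theta> where x: "x = polar r \<theta>" "s \<le> \<theta>" "\<theta> \<le> t" "r1 \<theta> \<le> r" "r \<le> r2 \<theta>"
      by (auto simp: closed_strip_def)
    define q where "q = (r - r1 \<theta>) / (r2 \<theta> - r1 \<theta>)"
    have lt: "r1 \<theta> < r2 \<theta>" using r1_less_r2 x assms by simp
    then have "q * (r2 \<theta> - r1 \<theta>) = r - r1 \<theta>" by (simp add: q_def)
    then have "x = F (\<theta>, q)" by (simp add: x(1) F_def)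
    moreover have "0 \<le> q" "q \<le> 1" using lt x(4,5) by (simp_all add: q_def divide_le_eq)
    ultimately show "x \<in> F ` ({s..t} \<times> {0..1})" using x(2,3) by (intro image_eqI[of _ _ "(\<theta>, q)"]) auto
  next
    fix x assume "x \<in> F ` ({s..t} \<times> {0..1})"
    then obtain \<theta> q where x: "s \<le> \<theta>" "\<theta> \<le> t" "0 \<le> q" "q \<le> 1" "x = F (\<theta>, q)" by auto
    have "r1 \<theta> < r2 \<theta>" using r1_less_r2 x assms by simp
    then have "0 \<le> q * (r2 \<theta> - r1 \<theta>)" "q * (r2 \<theta> - r1 \<theta>) \<le> r2 \<theta> - r1 \<theta>"
      using x by (auto intro: mult_left_le_one_le)
    with x show "x \<in> closed_strip s t"
      unfolding closed_strip_def F_def by force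
  qed
  moreover have "continuous_on ({s..t} \<times> {0..1}) F"
  proof -
    have c: "continuous_on ({s..t} \<times> {0..1}) (\<lambda>p. r1 (fst p))"
       "continuous_on ({s..t} \<times> {0..1}) (\<lambda>p. r2 (fst p))"
      using assms by (auto intro!: continuous_on_compose2[OF r1_cont]
          continuous_on_compose2[OF r2_cont] continuous_intros)
    have "F = (\<lambda>p. \<chi> i. (r1 (fst p) + snd p * (r2 (fst p) - r1 (fst p)))
        * (if i = 1 then cos (fst p) else sin (fst p)))"
      by (simp add: F_def polar_def fun_eq_iff vec_eq_iff forall_2)
    moreover have "continuous_on ({s..t} \<times> {0..1}) (\<lambda>p::real\<times>real. if i = 1 then cos (fst p) else sin (fst p))" for i :: 2
      by (cases "i = 1") (auto intro!: continuous_intros)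
    ultimately show ?thesis
      by (auto intro!: continuous_on_vec_lambda continuous_intros c)
  qed
  ultimately show ?thesis
    by (auto intro!: compact_continuous_image compact_Times)
qed

end

section \<open>Comparison on strips\<close>

locale elliptic_spiral = spiral_domain +
  fixes A :: "real^2 \<Rightarrow> real^2^2" and b :: "real^2 \<Rightarrow> real^2" and c0 M1 :: real
  assumes A_sym: "x \<in> spiral \<theta>0 r1 r2 \<Longrightarrow> transpose (A x) = A x"
    and elliptic: "x \<in> spiral \<theta>0 r1 r2 \<Longrightarrow> \<xi> \<bullet> (A x *v \<xi>) \<ge> c0 * (norm \<xi>)\<^sup>2"
    and trace_le: "x \<in> spiral \<theta>0 r1 r2 \<Longrightarrow> trace (A x) \<le> M1"
    and c0_pos: "0 < c0" and M1_pos: "0 < M1"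
begin

definition subsolution :: "(real^2 \<Rightarrow> real) \<Rightarrow> bool" where
  "subsolution u \<longleftrightarrow> C2_on (spiral \<theta>0 r1 r2) u \<and> continuous_on (spiral_closed \<theta>0 r1 r2) u
     \<and> (\<forall>x\<in>spiral \<theta>0 r1 r2. elliptic_op A b u x \<le> 0)
     \<and> (\<forall>x\<in>spiral_sides \<theta>0 r1 r2. u x \<le> 0)"

text \<open>The maximum of \<open>u + k gauss\<close> on the compact strip is not attained in the open strip, because
  there \<open>elliptic_op_pos_at_barrier_max\<close> would contradict \<open>L u \<le> 0\<close>.  On the sides \<open>u \<le> 0\<close>, so only the
  barrier itself has to be bounded there.\<close>

lemma barrier_comparison:
  assumes u: "subsolution u" and s: "\<theta>0 \<le> s"
    and B: "\<And>x. x \<in> spiral_strip r1 r2 {s<..<t} \<Longrightarrow> norm (b x) \<le> B"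
    and \<rho>: "0 < \<rho>" "\<And>x. x \<in> spiral_strip r1 r2 {s<..<t} \<Longrightarrow> \<rho> \<le> norm (x - z)"
    and \<alpha>: "M1 + B * \<rho> < 2 * \<alpha> * c0 * \<rho>\<^sup>2"
    and k: "0 < k"
    and sides: "\<And>x. x \<in> spiral_sides \<theta>0 r1 r2 \<Longrightarrow> x \<in> closed_strip s t \<Longrightarrow> k * gauss \<alpha> z x \<le> K"
    and ends: "\<And>x. x \<in> spiral_section r1 r2 s \<union> spiral_section r1 r2 t \<Longrightarrow> u x + k * gauss \<alpha> z x \<le> K"
    and x: "x \<in> closed_strip s t"
  shows "u x + k * gauss \<alpha> z x \<le> K"
proof -
  define f where "f x = u x + k * gauss \<alpha> z x" for x
  have "closed_strip s t \<subseteq> spiral_closed \<theta>0 r1 r2"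
    using s by (fastforce simp: closed_strip_def spiral_closed_def)
  then have "continuous_on (closed_strip s t) u"
    using u continuous_on_subset by (auto simp: subsolution_def)
  then have "continuous_on (closed_strip s t) f"
    unfolding f_def gauss_def by (intro continuous_intros)
  then obtain w where w: "w \<in> closed_strip s t" "\<And>y. y \<in> closed_strip s t \<Longrightarrow> f y \<le> f w"
    using continuous_attains_sup[OF compact_closed_strip[OF s]] x by blast
  have "f w \<le> K"
  proof -
    obtain r \<theta> where r\<theta>: "w = polar r \<theta>" "s \<le> \<theta>" "\<theta> \<le> t" "r1 \<theta> \<le> r" "r \<le> r2 \<theta>"
      using w(1) by (auto simp: closed_strip_def)
    consider "\<theta> = s \<or> \<theta> = t" | "r = r1 \<theta> \<or> r = r2 \<theta>"
      | "s < \<theta>" "\<theta> < t" "r1 \<theta> < r" "r < r2 \<theta>"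
      using r\<theta> by linarith
    then show ?thesis
    proof cases
      case 1
      then have "w \<in> spiral_section r1 r2 s \<union> spiral_section r1 r2 t"
        using r\<theta> by (auto simp: spiral_section_def)
      then show ?thesis unfolding f_def by (rule ends)
    next
      case 2
      then have side: "w \<in> spiral_sides \<theta>0 r1 r2"
        using r\<theta> s by (auto simp: spiral_sides_def)
      then have "u w \<le> 0" using u by (simp add: subsolution_def)
      with sides[OF side w(1)] show ?thesis by (simp add: f_def)
    next
      case 3
      let ?V = "spiral_strip r1 r2 {s<..<t}"
      have wV: "w \<in> ?V" using 3 r\<theta>(1) by (auto simp: spiral_strip_def)
      then have wU: "w \<in> spiral \<theta>0 r1 r2" using strip_subset_spiral[OF s] by blast
      have near: "\<forall>\<^sub>F y in nhds w. y \<in> ?V"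
        using open_spiral_strip[OF s] wV by (rule eventually_nhds_in_open)
      have "0 < elliptic_op A b u w"
      proof (rule elliptic_op_pos_at_barrier_max[where x = w and z = z and k = k and ?M1.0 = M1 and B = B and \<rho> = \<rho> and ?c0.0 = c0 and \<alpha> = \<alpha>])
        show "\<forall>\<^sub>F y in nhds w. u differentiable (at y)"
          using near by (rule eventually_mono)
            (use u strip_subset_spiral[OF s, of t] in \<open>auto simp: subsolution_def C2_on_def C1_on_def\<close>)
        show "pderiv_at j u differentiable (at w)" for j
          using u wU by (auto simp: subsolution_def C2_on_def C1_on_def)
        show "\<forall>\<^sub>F y in nhds w. u y + k * gauss \<alpha> z y \<le> u w + k * gauss \<alpha> z w"
          using near
        proof (rule eventually_mono)
          fix y assume "y \<in> ?V"
          then have "y \<in> closed_strip s t"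
            unfolding spiral_strip_def closed_strip_def by force
          from w(2)[OF this] show "u y + k * gauss \<alpha> z y \<le> u w + k * gauss \<alpha> z w"
            by (simp add: f_def)
        qed
      qed (rule A_sym[OF wU] elliptic[OF wU] trace_le[OF wU] c0_pos less_imp_le[OF M1_pos]
          B[OF wV] \<rho>(1) \<rho>(2)[OF wV] \<alpha> k)+
      moreover have "elliptic_op A b u w \<le> 0" using u wU by (simp add: subsolution_def)
      ultimately show ?thesis by simp
    qed
  qed
  with w(2)[OF x] show ?thesis by (simp add: f_def)
qed

lemma section_max_bounds:
  assumes "subsolution u" "\<theta>0 \<le> \<theta>"
  shows "0 \<le> section_max r1 r2 u \<theta>"
    and "x \<in> spiral_section r1 r2 \<theta> \<Longrightarrow> u x \<le> section_max r1 r2 u \<theta>"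
    and "\<lbrakk>\<And>x. x \<in> spiral_section r1 r2 \<theta> \<Longrightarrow> u x \<le> K; 0 \<le> K\<rbrakk> \<Longrightarrow> section_max r1 r2 u \<theta> \<le> K"
proof -
  have "spiral_section r1 r2 \<theta> \<subseteq> spiral_closed \<theta>0 r1 r2"
    using assms(2) by (fastforce simp: spiral_section_def spiral_closed_def)
  then have "continuous_on (spiral_section r1 r2 \<theta>) u"
    using assms(1) continuous_on_subset by (auto simp: subsolution_def)
  then obtain w where w: "w \<in> spiral_section r1 r2 \<theta>" "section_max r1 r2 u \<theta> = max 0 (u w)"
    "\<And>y. y \<in> spiral_section r1 r2 \<theta> \<Longrightarrow> max 0 (u y) \<le> section_max r1 r2 u \<theta>"
    using section_max_attained[of r1 \<theta> r2 u] r1_less_r2[OF assms(2)] by auto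
  show "0 \<le> section_max r1 r2 u \<theta>" using w(2) by simp
  show "u x \<le> section_max r1 r2 u \<theta>" if "x \<in> spiral_section r1 r2 \<theta>"
    using w(3)[OF that] by simp
  show "section_max r1 r2 u \<theta> \<le> K" if "\<And>x. x \<in> spiral_section r1 r2 \<theta> \<Longrightarrow> u x \<le> K" "0 \<le> K"
    using w(1,2) that by simp
qed

lemma section_subset_closed_strip:
  "s \<le> \<theta> \<Longrightarrow> \<theta> \<le> t \<Longrightarrow> spiral_section r1 r2 \<theta> \<subseteq> closed_strip s t"
  by (auto simp: spiral_section_def closed_strip_def)

text \<open>This is the weak maximum principle on a strip.  The barrier is centred at the origin, from which
  the strip has positive distance, and its height \<open>k\<close> is sent to zero.\<close>

lemma section_max_quasiconvex:
  assumes u: "subsolution u" and b: "bounded (b ` spiral_strip r1 r2 {s<..<t})"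
    and s: "\<theta>0 \<le> s" and \<theta>: "s \<le> \<theta>" "\<theta> \<le> t"
  shows "section_max r1 r2 u \<theta> \<le> max (section_max r1 r2 u s) (section_max r1 r2 u t)"
    (is "_ \<le> ?M")
proof (rule section_max_bounds(3)[OF u])
  show "\<theta>0 \<le> \<theta>" using s \<theta> by simp
  show "0 \<le> ?M" using section_max_bounds(1)[OF u s] by simp
  fix x assume x: "x \<in> spiral_section r1 r2 \<theta>"
  obtain B where B: "\<And>x. x \<in> spiral_strip r1 r2 {s<..<t} \<Longrightarrow> norm (b x) \<le> B"
    using b by (auto simp: bounded_iff)
  have "continuous_on {s..t} r1" using r1_cont s by (auto intro: continuous_on_subset)
  then obtain \<eta> where \<eta>: "\<eta> \<in> {s..t}" "\<And>\<zeta>. \<zeta> \<in> {s..t} \<Longrightarrow> r1 \<eta> \<le> r1 \<zeta>"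
    using continuous_attains_inf[of "{s..t}" r1] \<theta> by auto
  define \<rho> where "\<rho> = r1 \<eta>"
  have \<rho>0: "0 < \<rho>" using r1_pos \<eta> s by (simp add: \<rho>_def)
  have \<rho>: "\<rho> \<le> norm (x - 0)" if xs: "x \<in> spiral_strip r1 r2 {s<..<t}" for x
  proof -
    obtain r \<zeta> where "x = polar r \<zeta>" "s < \<zeta>" "\<zeta> < t" "r1 \<zeta> < r"
      using xs by (auto simp: spiral_strip_def)
    then show ?thesis using \<eta>(2)[of \<zeta>] by (simp add: norm_polar \<rho>_def)
  qed
  define \<alpha> where "\<alpha> = (\<bar>M1 + B * \<rho>\<bar> + 1) / (2 * c0 * \<rho>\<^sup>2)"
  have "2 * \<alpha> * c0 * \<rho>\<^sup>2 = \<bar>M1 + B * \<rho>\<bar> + 1"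
    using c0_pos \<rho>0 by (simp add: \<alpha>_def)
  then have \<alpha>: "M1 + B * \<rho> < 2 * \<alpha> * c0 * \<rho>\<^sup>2" by linarith
  have "0 \<le> \<alpha>" using c0_pos by (simp add: \<alpha>_def)
  then have g: "0 \<le> gauss \<alpha> 0 y" "gauss \<alpha> 0 y \<le> 1" for y by (auto simp: gauss_def)
  show "u x \<le> ?M"
  proof (rule field_le_epsilon)
    fix k :: real assume k: "0 < k"
    have kg: "0 \<le> k * gauss \<alpha> 0 y" "k * gauss \<alpha> 0 y \<le> k" for y
      using k g[of y] by (auto intro: mult_left_le)
    have "u x + k * gauss \<alpha> 0 x \<le> ?M + k"
    proof (rule barrier_comparison[OF u s B \<rho>0 \<rho> \<alpha> k])
      show "k * gauss \<alpha> 0 y \<le> ?M + k" for y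
        using kg[of y] section_max_bounds(1)[OF u s] by simp
      show "u y + k * gauss \<alpha> 0 y \<le> ?M + k"
        if "y \<in> spiral_section r1 r2 s \<union> spiral_section r1 r2 t" for y
        using that kg[of y] section_max_bounds(2)[OF u, of s y] section_max_bounds(2)[OF u, of t y] s \<theta>
        by fastforce
      show "x \<in> closed_strip s t"
        using x section_subset_closed_strip \<theta> by blast
    qed
    with kg[of x] show "u x \<le> ?M + k" by simp
  qed
qed

section \<open>Contraction on a window of half a turn\<close>

text \<open>This growth lemma is the quantitative core.  The barrier is centred at \<open>z\<close>, half way between the
  origin and the limit circle of radius \<open>R\<close>, on the ray of angle \<open>\<theta>\<close>.  The circle of radius \<open>R / 2\<close>
  around \<open>z\<close> touches the limit circle from inside exactly on this ray.  So every point of the strip has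
  distance at least \<open>\<rho> = R / 2 - \<epsilon>\<close> from \<open>z\<close>, those on the middle section have distance at most
  \<open>R / 2 + \<epsilon>\<close>, and those on the end sections, a quarter turn away, have distance at least \<open>R\<close>.
  Normalised to be at most \<open>1\<close> on the strip, the barrier exceeds on the middle section its values on
  the end sections by at least \<open>exp (- \<alpha> (P - \<rho>\<^sup>2)) - exp (- \<alpha> (R\<^sup>2 - \<rho>\<^sup>2))\<close> with
  \<open>P = (R / 2 + \<epsilon>)\<^sup>2\<close>, and this is the gain.

  The exponent \<open>\<alpha>\<close> must grow linearly in the drift bound \<open>B\<close>, but it is multiplied by
  \<open>P - \<rho>\<^sup>2 = 2 R \<epsilon>\<close>.  In a thin strip the gain is therefore at least a constant times \<open>exp (- B l)\<close>,
  with \<open>l\<close> as small as the strip is thin.\<close>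

lemma window_contraction:
  fixes R \<epsilon> l :: real
  assumes R: "0 < R" and \<epsilon>: "0 \<le> \<epsilon>" "8 * \<epsilon> \<le> R" "16 * \<epsilon> \<le> 3 * c0 * l"
  shows "\<exists>c>0. \<forall>u \<theta> B. subsolution u \<longrightarrow> \<theta>0 \<le> \<theta> - pi / 2 \<longrightarrow> 0 \<le> B \<longrightarrow>
    (\<forall>\<zeta>\<in>{\<theta> - pi / 2..\<theta> + pi / 2}. R - \<epsilon> \<le> r1 \<zeta> \<and> r2 \<zeta> \<le> R + \<epsilon>) \<longrightarrow>
    (\<forall>x\<in>spiral_strip r1 r2 {\<theta> - pi / 2<..<\<theta> + pi / 2}. norm (b x) \<le> B) \<longrightarrow>
    section_max r1 r2 u \<theta> \<le> (1 - c * exp (- B * l))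
      * max (section_max r1 r2 u (\<theta> - pi / 2)) (section_max r1 r2 u (\<theta> + pi / 2))"
proof -
  define \<rho> where "\<rho> = R / 2 - \<epsilon>"
  define P where "P = (R / 2 + \<epsilon>)\<^sup>2"
  define \<alpha>0 where "\<alpha>0 = M1 / \<rho>\<^sup>2 / c0"
  define c where "c = exp (- (M1 / \<rho>) * l) * (1 - exp (- \<alpha>0 * (R\<^sup>2 - P)))"
  have \<rho>: "3 * R / 8 \<le> \<rho>" "0 < \<rho>" using \<epsilon> R by (auto simp: \<rho>_def)
  have "P \<le> (5 * R / 8)\<^sup>2" unfolding P_def using \<epsilon> R by (intro power_mono) auto
  also have "\<dots> < R\<^sup>2" using R by (simp add: power2_eq_square field_simps)
  finally have PR: "P < R\<^sup>2" .
  have \<alpha>0: "0 < \<alpha>0" using M1_pos c0_pos \<rho> by (simp add: \<alpha>0_def)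
  have "0 < c" using \<alpha>0 PR by (simp add: c_def)
  moreover have "section_max r1 r2 u \<theta> \<le> (1 - c * exp (- B * l)) * max (section_max r1 r2 u s) (section_max r1 r2 u t)"
    if u: "subsolution u" and s: "\<theta>0 \<le> s" and B0: "0 \<le> B"
      and st: "s = \<theta> - pi / 2" "t = \<theta> + pi / 2"
      and thin: "\<And>\<zeta>. s \<le> \<zeta> \<Longrightarrow> \<zeta> \<le> t \<Longrightarrow> R - \<epsilon> \<le> r1 \<zeta> \<and> r2 \<zeta> \<le> R + \<epsilon>"
      and B: "\<And>x. x \<in> spiral_strip r1 r2 {s<..<t} \<Longrightarrow> norm (b x) \<le> B" for u \<theta> B s t
  proof -
    define m where "m = max (section_max r1 r2 u s) (section_max r1 r2 u t)"
    have \<theta>: "s \<le> \<theta>" "\<theta> \<le> t" "\<theta>0 \<le> \<theta>" "\<theta>0 \<le> t" using pi_gt_zero s st by linarith+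
    have m0: "0 \<le> m" using section_max_bounds(1)[OF u s] by (simp add: m_def)
    show ?thesis
    proof (cases "m = 0")
      case True
      have "bounded (b ` spiral_strip r1 r2 {s<..<t})" using B by (auto simp: bounded_iff)
      from section_max_quasiconvex[OF u this s \<theta>(1,2)] True show ?thesis by (simp add: m_def)
    next
      case False
      with m0 have m: "0 < m" by simp
      define z where "z = polar (R / 2) \<theta>"
      \<comment> \<open>Twice the least value that the barrier admits, so that the inequality for \<open>\<alpha>\<close> is strict.\<close>
      define \<alpha> where "\<alpha> = (M1 / \<rho>\<^sup>2 + B / \<rho>) / c0"
      \<comment> \<open>This height makes the barrier at most \<open>m\<close> on the whole strip.\<close>
      define k where "k = m * exp (\<alpha> * \<rho>\<^sup>2)"
      define e1 e2 where "e1 = exp (- \<alpha> * (P - \<rho>\<^sup>2))" and "e2 = exp (- \<alpha> * (R\<^sup>2 - \<rho>\<^sup>2))"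
      have \<alpha>: "\<alpha>0 \<le> \<alpha>" unfolding \<alpha>_def \<alpha>0_def using B0 \<rho> c0_pos by (intro divide_right_mono) auto
      have kg: "k * gauss \<alpha> z y = m * exp (- \<alpha> * ((norm (y - z))\<^sup>2 - \<rho>\<^sup>2))" for y
        by (simp add: k_def gauss_def exp_add[symmetric] algebra_simps)
      have far: "\<rho> \<le> norm (y - z)" if ys: "y \<in> closed_strip s t" for y
      proof -
        obtain r \<zeta> where y: "y = polar r \<zeta>" "s \<le> \<zeta>" "\<zeta> \<le> t" "r1 \<zeta> \<le> r"
          using ys by (auto simp: closed_strip_def)
        have "R - \<epsilon> \<le> \<bar>r\<bar>" using thin[OF y(2,3)] y(4) by linarith
        then have "\<rho> \<le> norm y - norm z"
          using R by (simp add: y(1) norm_polar z_def \<rho>_def)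
        also have "\<dots> \<le> norm (y - z)" by (rule norm_triangle_ineq2)
        finally show ?thesis .
      qed
      have ends: "k * gauss \<alpha> z y \<le> m * e2"
        if ys: "y \<in> spiral_section r1 r2 s \<union> spiral_section r1 r2 t" for y
      proof -
        obtain r \<zeta> where y: "y = polar r \<zeta>" "\<zeta> = s \<or> \<zeta> = t" "r1 \<zeta> \<le> r"
          using ys by (auto simp: spiral_section_def)
        have "cos (\<zeta> - \<theta>) = 0" using y(2) st by (auto simp: cos_minus)
        then have n: "(norm (y - z))\<^sup>2 = r\<^sup>2 + R\<^sup>2 / 4"
          by (simp add: y(1) z_def norm_polar_diff power_divide)
        have "7 * R / 8 \<le> r" using thin[of \<zeta>] y \<theta> \<epsilon> by auto
        then have "(7 * R / 8)\<^sup>2 \<le> r\<^sup>2" using R by (intro power_mono) auto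
        then have sq: "49 / 64 * R\<^sup>2 \<le> r\<^sup>2" by (simp add: power2_eq_square)
        have "R\<^sup>2 \<le> (norm (y - z))\<^sup>2"
          unfolding n using zero_le_power2[of R] sq by linarith
        then have "- \<alpha> * ((norm (y - z))\<^sup>2 - \<rho>\<^sup>2) \<le> - \<alpha> * (R\<^sup>2 - \<rho>\<^sup>2)"
          using \<alpha> \<alpha>0 by (intro mult_left_mono_neg) auto
        then show ?thesis unfolding kg e2_def using m by simp
      qed
      have upper: "u x \<le> m * (1 - (e1 - e2))" if x: "x \<in> spiral_section r1 r2 \<theta>" for x
      proof -
        have "u x + k * gauss \<alpha> z x \<le> m + m * e2"
        proof (rule barrier_comparison[OF u s B \<rho>(2)])
          show "\<rho> \<le> norm (y - z)" if "y \<in> spiral_strip r1 r2 {s<..<t}" for y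
            using that by (intro far) (force simp: spiral_strip_def closed_strip_def)
          have "2 * \<alpha> * c0 * \<rho>\<^sup>2 = 2 * (M1 + B * \<rho>)"
            using c0_pos \<rho> by (simp add: \<alpha>_def field_simps power2_eq_square)
          moreover have "0 \<le> B * \<rho>" using B0 \<rho> by simp
          ultimately show "M1 + B * \<rho> < 2 * \<alpha> * c0 * \<rho>\<^sup>2" using M1_pos by simp
          show "0 < k" using m by (simp add: k_def)
          show "k * gauss \<alpha> z y \<le> m + m * e2" if "y \<in> closed_strip s t" for y
          proof -
            have "\<rho>\<^sup>2 \<le> (norm (y - z))\<^sup>2" using far[OF that] \<rho> by (intro power_mono) auto
            then have "k * gauss \<alpha> z y \<le> m"
              unfolding kg using m \<alpha> \<alpha>0 by (intro mult_left_le) auto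
            also have "\<dots> \<le> m + m * e2" using m by (simp add: e2_def)
            finally show ?thesis .
          qed
          show "u y + k * gauss \<alpha> z y \<le> m + m * e2"
            if "y \<in> spiral_section r1 r2 s \<union> spiral_section r1 r2 t" for y
          proof -
            have "u y \<le> m"
              using that section_max_bounds(2)[OF u s, of y] section_max_bounds(2)[OF u \<theta>(4), of y]
              by (auto simp: m_def)
            with ends[OF that] show ?thesis by simp
          qed
          show "x \<in> closed_strip s t" using x section_subset_closed_strip \<theta> by blast
        qed
        moreover have "m * e1 \<le> k * gauss \<alpha> z x"
        proof -
          obtain r where r: "x = polar r \<theta>" "r1 \<theta> \<le> r" "r \<le> r2 \<theta>"
            using x by (auto simp: spiral_section_def)
          have "x - z = polar (r - R / 2) \<theta>"
            by (simp add: r(1) z_def polar_def vec_eq_iff forall_2 algebra_simps)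
          then have "norm (x - z) \<le> R / 2 + \<epsilon>"
            using thin[OF \<theta>(1,2)] r \<epsilon> R by (simp add: norm_polar)
          then have "(norm (x - z))\<^sup>2 \<le> P" unfolding P_def by (intro power_mono) auto
          then have "- \<alpha> * (P - \<rho>\<^sup>2) \<le> - \<alpha> * ((norm (x - z))\<^sup>2 - \<rho>\<^sup>2)"
            using \<alpha> \<alpha>0 by (intro mult_left_mono_neg) auto
          then show ?thesis unfolding kg e1_def using m by simp
        qed
        ultimately show ?thesis by (simp add: algebra_simps)
      qed
      have "c * exp (- B * l) \<le> e1 - e2"
      proof -
        define d where "d = 2 * R * \<epsilon> / (\<rho> * c0)"
        have "6 * R * \<epsilon> \<le> 16 * \<rho> * \<epsilon>" using \<rho>(1) \<epsilon>(1) mult_right_mono[of "6 * R" "16 * \<rho>" \<epsilon>] by linarith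
        also have "\<dots> \<le> \<rho> * (3 * c0 * l)" using mult_left_mono[OF \<epsilon>(3), of \<rho>] \<rho> by simp
        finally have d: "d \<le> l" using \<rho> c0_pos by (simp add: d_def field_simps)
        have "P - \<rho>\<^sup>2 = 2 * R * \<epsilon>"
          by (simp add: P_def \<rho>_def power2_eq_square algebra_simps)
        moreover have "\<alpha> = (M1 / \<rho> + B) / (\<rho> * c0)"
          using \<rho>(2) c0_pos by (simp add: \<alpha>_def power2_eq_square add_divide_distrib)
        ultimately have "\<alpha> * (P - \<rho>\<^sup>2) = (M1 / \<rho> + B) * d"
          by (simp add: d_def)
        also have "\<dots> \<le> (M1 / \<rho> + B) * l"
          using d B0 M1_pos \<rho> by (intro mult_left_mono) auto
        finally have 1: "exp (- (M1 / \<rho>) * l) * exp (- B * l) \<le> e1"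
          unfolding e1_def exp_add[symmetric] by (simp add: algebra_simps)
        have "\<alpha>0 * (R\<^sup>2 - P) \<le> \<alpha> * (R\<^sup>2 - P)" using \<alpha> PR by (intro mult_right_mono) auto
        then have 2: "1 - exp (- \<alpha>0 * (R\<^sup>2 - P)) \<le> 1 - exp (- \<alpha> * (R\<^sup>2 - P))" by simp
        have "c * exp (- B * l) = (exp (- (M1 / \<rho>) * l) * exp (- B * l)) * (1 - exp (- \<alpha>0 * (R\<^sup>2 - P)))"
          by (simp add: c_def)
        also have "\<dots> \<le> e1 * (1 - exp (- \<alpha> * (R\<^sup>2 - P)))"
          using 1 2 \<alpha>0 PR by (intro mult_mono) (auto simp: e1_def)
        also have "\<dots> = e1 - e2"
          by (simp add: e1_def e2_def right_diff_distrib exp_add[symmetric] algebra_simps)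
        finally show ?thesis .
      qed
      then have "m * (1 - (e1 - e2)) \<le> (1 - c * exp (- B * l)) * m" using m by (simp add: mult.commute)
      moreover have "section_max r1 r2 u \<theta> \<le> m * (1 - (e1 - e2))"
      proof (rule section_max_bounds(3)[OF u \<theta>(3) upper])
        have "e1 \<le> 1"
        proof -
          have "\<rho>\<^sup>2 \<le> P" unfolding P_def \<rho>_def using R \<epsilon> by (intro power_mono) auto
          then show ?thesis using \<alpha> \<alpha>0 by (simp add: e1_def)
        qed
        moreover have "0 \<le> e2" by (simp add: e2_def)
        ultimately show "0 \<le> m * (1 - (e1 - e2))" using m by simp
      qed
      ultimately show ?thesis by (simp add: m_def)
    qed
  qed
  ultimately show ?thesis
    by (intro exI[of _ c]) auto
qed

end

section \<open>Iterating a contraction with an antitone rate\<close>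

lemma antimono_on_integrable:
  fixes g :: "real \<Rightarrow> real"
  assumes "antimono_on {a..} g" "a \<le> s"
  shows "g integrable_on {s..t}"
proof -
  have "mono_on {s..t} (\<lambda>x. - g x)"
    using assms by (auto simp: monotone_on_def)
  from integrable_neg[OF integrable_on_mono_on[OF this]] show ?thesis by simp
qed

lemma antimono_on_integral_le:
  fixes g :: "real \<Rightarrow> real"
  assumes "antimono_on {a..} g" "a \<le> s" "s \<le> t"
  shows "integral {s..t} g \<le> (t - s) * g s"
proof -
  have "integral {s..t} g \<le> integral {s..t} (\<lambda>_. g s)"
    using assms by (intro integral_le antimono_on_integrable) (auto simp: monotone_on_def)
  then show ?thesis using assms(3) by simp
qed

lemma integral_at_top_of_nn_integral_infinite:
  fixes g :: "real \<Rightarrow> real"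
  assumes anti: "antimono_on {a..} g" and nonneg: "\<And>x. a \<le> x \<Longrightarrow> 0 \<le> g x"
    and inf: "(\<integral>\<^sup>+x\<in>{a..}. ennreal (g x) \<partial>lborel) = \<infinity>"
  shows "filterlim (\<lambda>t. integral {a..t} g) at_top at_top"
  unfolding filterlim_at_top
proof
  fix K :: real
  define f where "f n x = ennreal (g (max a x)) * indicator {a..a + real n} x" for n x
  \<comment> \<open>Freezing \<open>g\<close> to the left of \<open>a\<close> makes it monotone, hence Borel, on the whole line.\<close>
  have "mono (\<lambda>x. - g (max a x))"
    using anti by (auto simp: monotone_on_def mono_def)
  from borel_measurable_uminus[OF borel_measurable_mono[OF this]]
  have [measurable]: "(\<lambda>x. g (max a x)) \<in> borel_measurable borel" by simp
  have int: "(\<integral>\<^sup>+x. f n x \<partial>lborel) = ennreal (integral {a..a + real n} g)" for n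
  proof -
    have "(\<integral>\<^sup>+x. f n x \<partial>lborel)
        = (\<integral>\<^sup>+x. ennreal (g x) * indicator {a..a + real n} x \<partial>lborel)"
      by (intro nn_integral_cong) (auto simp: f_def indicator_def max_def)
    also have "\<dots> = ennreal (integral {a..a + real n} g)"
      by (intro nn_integral_has_integral_lebesgue' integrable_integral
          antimono_on_integrable[OF anti]) (auto intro: nonneg)
    finally show ?thesis .
  qed
  have sup: "(SUP n. f n x) = ennreal (g x) * indicator {a..} x" for x
  proof (cases "a \<le> x")
    case True
    obtain n where n: "x \<le> a + real n"
      using real_arch_simple[of "x - a"] by (auto simp: algebra_simps)
    show ?thesis
    proof (rule antisym)
      show "(SUP n. f n x) \<le> ennreal (g x) * indicator {a..} x"
        using True by (intro SUP_least) (auto simp: f_def indicator_def)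
      have "ennreal (g x) * indicator {a..} x = f n x"
        using True n by (auto simp: f_def)
      then show "ennreal (g x) * indicator {a..} x \<le> (SUP n. f n x)"
        by (auto intro: SUP_upper)
    qed
  qed (auto simp: f_def)
  have "(SUP n. \<integral>\<^sup>+x. f n x \<partial>lborel) = (\<integral>\<^sup>+x. (SUP n. f n x) \<partial>lborel)"
  proof (rule nn_integral_monotone_convergence_SUP[symmetric])
    show "incseq f"
      by (auto simp: incseq_def le_fun_def f_def indicator_def)
    show "f n \<in> borel_measurable lborel" for n
      unfolding f_def by measurable
  qed
  also have "\<dots> = \<infinity>" using inf by (simp add: sup)
  finally have "(SUP n. ennreal (integral {a..a + real n} g)) = top"
    by (simp only: int infinity_ennreal_def)
  then have "ennreal K < (SUP n. ennreal (integral {a..a + real n} g))"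
    by (simp only: ennreal_less_top)
  then obtain n where "ennreal K < ennreal (integral {a..a + real n} g)"
    by (auto simp: less_SUP_iff)
  then have n: "K < integral {a..a + real n} g"
    by (metis ennreal_leI not_le)
  have "K \<le> integral {a..t} g" if "a + real n \<le> t" for t
  proof -
    have "integral {a..a + real n} g \<le> integral {a..t} g"
      using that by (intro integral_subset_le antimono_on_integrable[OF anti]) (auto intro: nonneg)
    with n show ?thesis by simp
  qed
  then show "\<forall>\<^sub>F t in at_top. K \<le> integral {a..t} g"
    by (auto simp: eventually_at_top_linorder)
qed

lemma one_minus_mult_le_exp:
  fixes x y :: real
  assumes "0 \<le> y"
  shows "(1 - x) * y \<le> exp (- x) * y"
  using assms exp_ge_add_one_self[of "- x"] by (intro mult_right_mono) auto

text \<open>Each step of length \<open>h\<close> multiplies \<open>M\<close> by at most \<open>exp (- c g (t + h))\<close>, and \<open>h g (t + h)\<close> dominates the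
  integral of \<open>g\<close> over the interval of length \<open>h\<close> that follows \<open>t + h\<close>.  The first step ends at
  \<open>t = T + h\<close>, which is why the integral starts at \<open>T + 2 h\<close>.\<close>

lemma decay_of_contraction:
  fixes M g :: "real \<Rightarrow> real"
  assumes h: "0 < h" and c: "0 \<le> c"
    and anti: "antimono_on {T..} g"
    and noninc: "antimono_on {T..} M" and M_nonneg: "\<And>t. T \<le> t \<Longrightarrow> 0 \<le> M t"
    and contr: "\<And>t. T + h \<le> t \<Longrightarrow> M t \<le> (1 - c * g (t + h)) * M (t - h)"
    and nonneg: "\<And>t. T \<le> t \<Longrightarrow> 0 \<le> g t"
    and t: "T + 2 * h \<le> t"
  shows "M t \<le> M T * exp (- (c / h) * integral {T + 2 * h..t} g)"
proof -
  define I where "I s = integral {T + 2 * h..s} g" for s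
  have step: "M (T + real k * h) \<le> M T * exp (- (c / h) * I (T + real (k + 2) * h))" for k
  proof (induction k)
    case 0
    then show ?case by (simp add: I_def)
  next
    case (Suc k)
    define s where "s = T + real (k + 2) * h"
    have s: "T + 2 * h \<le> s" using h by (simp add: s_def algebra_simps)
    have hs: "T + real (Suc k + 2) * h = s + h" by (simp add: s_def algebra_simps)
    have "I (s + h) = I s + integral {s..s + h} g"
      unfolding I_def using s h
      by (intro Henstock_Kurzweil_Integration.integral_combine[symmetric] antimono_on_integrable[OF anti]) auto
    moreover have "integral {s..s + h} g \<le> h * g s"
      using antimono_on_integral_le[OF anti, of s "s + h"] s h by simp
    ultimately have "I (s + h) \<le> I s + h * g s" by simp
    then have "(c / h) * I (s + h) \<le> (c / h) * (I s + h * g s)"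
      using c h by (intro mult_left_mono) auto
    then have I: "- (c * g s) + - (c / h) * I s \<le> - (c / h) * I (s + h)"
      using h by (simp add: algebra_simps)
    have "M (T + real (Suc k) * h) \<le> (1 - c * g s) * M (T + real k * h)"
      using contr[of "T + real (Suc k) * h"] h by (simp add: s_def algebra_simps)
    also have "\<dots> \<le> exp (- (c * g s)) * M (T + real k * h)"
      using h by (intro one_minus_mult_le_exp M_nonneg) simp
    also have "\<dots> \<le> exp (- (c * g s)) * (M T * exp (- (c / h) * I s))"
      using Suc.IH unfolding s_def by (intro mult_left_mono) auto
    also have "\<dots> = M T * exp (- (c * g s) + - (c / h) * I s)"
      by (simp only: exp_add mult_ac)
    also have "\<dots> \<le> M T * exp (- (c / h) * I (s + h))"
      using I M_nonneg[of T] by (intro mult_left_mono) auto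
    finally show ?case by (simp only: hs)
  qed
  define k where "k = nat \<lfloor>(t - T) / h\<rfloor>"
  have "0 \<le> (t - T) / h" using t h by simp
  then have "real k \<le> (t - T) / h" "(t - T) / h < real k + 1"
    unfolding k_def by linarith+
  then have k: "T + real k * h \<le> t" "t \<le> T + real (k + 2) * h"
    using h by (auto simp: field_simps)
  have "T \<le> T + real k * h" using h by simp
  then have "M t \<le> M (T + real k * h)"
    using noninc k by (intro monotone_onD[OF noninc]) auto
  also have "\<dots> \<le> M T * exp (- (c / h) * I (T + real (k + 2) * h))"
    by (rule step)
  also have "\<dots> \<le> M T * exp (- (c / h) * I t)"
  proof -
    have "I t \<le> I (T + real (k + 2) * h)"
      unfolding I_def using k t h
      by (intro integral_subset_le antimono_on_integrable[OF anti]) (auto intro!: nonneg)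
    then show ?thesis using c h M_nonneg[of T]
      by (intro mult_left_mono) (auto intro: mult_left_mono divide_right_mono)
  qed
  finally show ?thesis by (simp add: I_def)
qed

text \<open>The same iteration read forwards: \<open>M\<close> gains the factor \<open>exp (c g (t + h))\<close> from \<open>t\<close> to \<open>t + h\<close>.\<close>

lemma growth_of_contraction:
  fixes M g :: "real \<Rightarrow> real"
  assumes h: "0 < h" and c: "0 \<le> c"
    and anti: "antimono_on {T..} g"
    and nondec: "mono_on {T..} M" and M_nonneg: "\<And>t. T \<le> t \<Longrightarrow> 0 \<le> M t"
    and contr: "\<And>t. T + h \<le> t \<Longrightarrow> M t \<le> (1 - c * g (t + h)) * M (t + h)"
    and nonneg: "\<And>t. T \<le> t \<Longrightarrow> 0 \<le> g t"
    and t: "T + 2 * h \<le> t"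
  shows "M t \<ge> M T * exp ((c / h) * integral {T + 2 * h..t} g)"
proof -
  define I where "I s = integral {T + 2 * h..s} g" for s
  have step: "M (T + real (k + 1) * h) \<ge> M T * exp ((c / h) * I (T + real (k + 2) * h))" for k
  proof (induction k)
    case 0
    then show ?case using nondec h by (simp add: I_def monotone_on_def)
  next
    case (Suc k)
    define s where "s = T + real (k + 2) * h"
    have s: "T + 2 * h \<le> s" using h by (simp add: s_def algebra_simps)
    have hs: "T + real (Suc k + 2) * h = s + h" by (simp add: s_def algebra_simps)
    have "I (s + h) = I s + integral {s..s + h} g"
      unfolding I_def using s h
      by (intro Henstock_Kurzweil_Integration.integral_combine[symmetric] antimono_on_integrable[OF anti]) auto
    moreover have "integral {s..s + h} g \<le> h * g s"
      using antimono_on_integral_le[OF anti, of s "s + h"] s h by simp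
    ultimately have "I (s + h) \<le> I s + h * g s" by simp
    then have "(c / h) * I (s + h) \<le> (c / h) * (I s + h * g s)"
      using c h by (intro mult_left_mono) auto
    then have I: "(c / h) * I (s + h) \<le> c * g s + (c / h) * I s"
      using h by (simp add: algebra_simps)
    have "M (s - h) \<le> (1 - c * g s) * M s"
      using contr[of "s - h"] s by simp
    also have "\<dots> \<le> exp (- (c * g s)) * M s"
      using s h by (intro one_minus_mult_le_exp M_nonneg) simp
    finally have "exp (c * g s) * M (s - h) \<le> exp (c * g s) * (exp (- (c * g s)) * M s)"
      by (intro mult_left_mono) auto
    then have 1: "exp (c * g s) * M (s - h) \<le> M s"
      by (simp add: mult.assoc[symmetric] exp_add[symmetric])
    have "M T * exp ((c / h) * I (s + h)) \<le> M T * exp (c * g s + (c / h) * I s)"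
      using I M_nonneg[of T] by (intro mult_left_mono) auto
    also have "\<dots> = exp (c * g s) * (M T * exp ((c / h) * I s))"
      by (simp only: exp_add mult_ac)
    also have "\<dots> \<le> exp (c * g s) * M (s - h)"
      using Suc.IH by (intro mult_left_mono) (auto simp: s_def algebra_simps)
    finally have "M T * exp ((c / h) * I (s + h)) \<le> M s" using 1 by simp
    then show ?case by (simp add: hs) (simp add: s_def algebra_simps)
  qed
  define k where "k = nat \<lfloor>(t - T) / h\<rfloor> - 1"
  have t2: "2 \<le> (t - T) / h" using t h by (simp add: field_simps)
  then have "real (k + 1) \<le> (t - T) / h" "(t - T) / h < real (k + 1) + 1"
    unfolding k_def by linarith+
  then have k: "T + real (k + 1) * h \<le> t" "t \<le> T + real (k + 2) * h"
    using h by (auto simp: field_simps)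
  have "M T * exp ((c / h) * I t) \<le> M T * exp ((c / h) * I (T + real (k + 2) * h))"
  proof -
    have "I t \<le> I (T + real (k + 2) * h)"
      unfolding I_def using k t h
      by (intro integral_subset_le antimono_on_integrable[OF anti]) (auto intro!: nonneg)
    then show ?thesis using c h M_nonneg[of T]
      by (intro mult_left_mono) (auto intro: mult_left_mono divide_right_mono)
  qed
  also have "\<dots> \<le> M (T + real (k + 1) * h)"
    by (rule step)
  also have "\<dots> \<le> M t"
    using k t h by (intro monotone_onD[OF nondec]) auto
  finally show ?thesis by (simp add: I_def)
qed

text \<open>A quasi-convex function cannot descend again once it has risen.\<close>

lemma quasiconvex_dichotomy:
  fixes M :: "real \<Rightarrow> real"
  assumes quasi: "\<And>s t v. a \<le> s \<Longrightarrow> s \<le> t \<Longrightarrow> t \<le> v \<Longrightarrow> M t \<le> max (M s) (M v)"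
  obtains "antimono_on {a..} M" | s t where "a \<le> s" "s < t" "M s < M t" "mono_on {t..} M"
proof (cases "antimono_on {a..} M")
  case False
  then obtain s t where st: "a \<le> s" "s \<le> t" "M s < M t"
    by (auto simp: monotone_on_def not_le)
  then have "s < t" by (cases "s = t") auto
  have above: "M t \<le> M v" if "t \<le> v" for v
    using quasi[of s t v] st that by auto
  have "mono_on {t..} M"
  proof (rule monotone_onI)
    fix v w assume "v \<in> {t..}" "w \<in> {t..}" "v \<le> w"
    then show "M v \<le> M w"
      using quasi[of s v w] above[of v] st by auto
  qed
  with st \<open>s < t\<close> that(2) show ?thesis by blast
qed (use that(1) in blast)

section \<open>The two possibilities\<close>

theorem theorem4p9:
  fixes \<theta>0 rstar c0 M1 \<Theta>bar \<kappa> :: real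
    and r1 r2 m :: "real \<Rightarrow> real"
    and A :: "real^2 \<Rightarrow> real^2^2"
    and b :: "real^2 \<Rightarrow> real^2"
  assumes r1_cont: "continuous_on {\<theta>0..} r1"
    and r2_cont: "continuous_on {\<theta>0..} r2"
    and r_pos: "\<forall>\<theta>\<ge>\<theta>0. r1 \<theta> > 0 \<and> r2 \<theta> > 0"
    and r_order: "\<forall>\<theta>\<ge>\<theta>0. r2 (\<theta> + 2 * pi) < r1 \<theta> \<and> r1 \<theta> < r2 \<theta>"
    and rstar_pos: "rstar > 0"
    and r1_lim: "(r1 \<longlongrightarrow> rstar) at_top"
    and r2_lim: "(r2 \<longlongrightarrow> rstar) at_top"
    and A_sym: "\<forall>x\<in>spiral \<theta>0 r1 r2. transpose (A x) = A x"
    and c0_pos: "c0 > 0"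
    and M1_pos: "M1 > 0"
    and A_elliptic: "\<forall>x\<in>spiral \<theta>0 r1 r2. \<forall>\<xi>. \<xi> \<bullet> (A x *v \<xi>) \<ge> c0 * (norm \<xi>)\<^sup>2"
    and A_trace: "\<forall>x\<in>spiral \<theta>0 r1 r2. trace (A x) \<le> M1"
    and \<Theta>bar_ge: "\<Theta>bar \<ge> \<theta>0"
    and m_mono: "mono_on {\<Theta>bar..} m"
    and m_nonneg: "\<forall>\<theta>\<ge>\<Theta>bar. m \<theta> \<ge> 0"
    and b_bounded: "bounded (b ` (spiral \<theta>0 r1 r2 \<inter> spiral_strip r1 r2 {\<theta>0..\<Theta>bar}))"
    and b_le_m: "\<forall>\<theta>\<ge>\<Theta>bar. \<forall>x\<in>spiral \<theta>0 r1 r2 \<inter> spiral_section r1 r2 \<theta>. norm (b x) \<le> m \<theta>"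
    and m_lim: "filterlim m at_top at_top"
    and \<kappa>_range: "0 < \<kappa>" "\<kappa> < 1"
    and \<kappa>_div: "(\<integral>\<^sup>+\<theta>\<in>{\<Theta>bar..}. ennreal (\<kappa> powr m \<theta>) \<partial>lborel) = \<infinity>"
  shows "\<exists>\<Theta>0 \<nu>. \<Theta>0 \<ge> \<Theta>bar \<and> \<nu> > 0 \<and>
    (\<forall>u :: real^2 \<Rightarrow> real.
       C2_on (spiral \<theta>0 r1 r2) u \<longrightarrow>
       continuous_on (spiral_closed \<theta>0 r1 r2) u \<longrightarrow>
       (\<forall>x\<in>spiral \<theta>0 r1 r2. elliptic_op A b u x \<le> 0) \<longrightarrow>
       (\<forall>x\<in>spiral_sides \<theta>0 r1 r2. u x \<le> 0) \<longrightarrow>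
       ((\<forall>\<theta>\<ge>\<theta>0. section_max r1 r2 u \<theta> \<le> section_max r1 r2 u \<theta>0 *
            (if \<theta> < \<Theta>0 then 1
             else min 1 (exp (- \<nu> * integral {\<Theta>0..\<theta>} (\<lambda>\<zeta>. \<kappa> powr m \<zeta>))))) \<and>
        (section_max r1 r2 u \<longlongrightarrow> 0) at_top)
       \<or>
       ((\<exists>C>0. \<forall>\<^sub>F \<theta> in at_top. section_max r1 r2 u \<theta> \<ge>
            C * exp (\<nu> * integral {\<Theta>bar..\<theta>} (\<lambda>\<zeta>. \<kappa> powr m \<zeta>))) \<and>
        filterlim (section_max r1 r2 u) at_top at_top))"
proof -
  interpret elliptic_spiral \<theta>0 r1 r2 A b c0 M1
    using r1_cont r2_cont r_pos r_order A_sym A_elliptic A_trace c0_pos M1_pos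
    by unfold_locales auto
  let ?M = "section_max r1 r2"
  define h where "h = pi / 2"
  define g where "g \<zeta> = \<kappa> powr m \<zeta>" for \<zeta>
  have g_eq: "g = (\<lambda>\<zeta>. \<kappa> powr m \<zeta>)" by (simp add: g_def fun_eq_iff)
  define l where "l = - ln \<kappa>"
  \<comment> \<open>So thin that the gain in \<open>window_contraction\<close> is at least a constant times
    \<open>\<kappa>\<close> to the power of the drift bound.\<close>
  define \<epsilon> where "\<epsilon> = min (rstar / 8) (3 * c0 * l / 16)"
  have h: "0 < h" by (simp add: h_def)
  have l: "0 < l" using \<kappa>_range by (simp add: l_def)
  have g_exp: "g \<zeta> = exp (- m \<zeta> * l)" for \<zeta>
    using \<kappa>_range by (simp add: g_def l_def powr_def)
  have g_anti: "antimono_on {\<Theta>bar..} g"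
    using m_mono l by (auto simp: g_exp monotone_on_def)
  have g_nonneg: "0 \<le> g \<zeta>" for \<zeta> by (simp add: g_def)

  have \<epsilon>: "0 < \<epsilon>" "8 * \<epsilon> \<le> rstar" "16 * \<epsilon> \<le> 3 * c0 * l"
    using rstar_pos c0_pos l by (auto simp: \<epsilon>_def min_def)
  obtain c where c: "0 < c" and window: "\<And>u \<theta> B. \<lbrakk>subsolution u; \<theta>0 \<le> \<theta> - h; 0 \<le> B;
      \<forall>\<zeta>\<in>{\<theta> - h..\<theta> + h}. rstar - \<epsilon> \<le> r1 \<zeta> \<and> r2 \<zeta> \<le> rstar + \<epsilon>;
      \<forall>x\<in>spiral_strip r1 r2 {\<theta> - h<..<\<theta> + h}. norm (b x) \<le> B\<rbrakk>
      \<Longrightarrow> ?M u \<theta> \<le> (1 - c * exp (- B * l)) * max (?M u (\<theta> - h)) (?M u (\<theta> + h))"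
    using window_contraction[OF rstar_pos _ \<epsilon>(2,3)] \<epsilon>(1) unfolding h_def by force
  have "\<forall>\<^sub>F \<zeta> in at_top. rstar - \<epsilon> \<le> r1 \<zeta> \<and> r2 \<zeta> \<le> rstar + \<epsilon>"
    using order_tendstoD(1)[OF r1_lim, of "rstar - \<epsilon>"] order_tendstoD(2)[OF r2_lim, of "rstar + \<epsilon>"] \<epsilon>(1)
    by (auto elim: eventually_elim2)
  then obtain T1 where T1: "\<And>\<zeta>. T1 \<le> \<zeta> \<Longrightarrow> rstar - \<epsilon> \<le> r1 \<zeta> \<and> r2 \<zeta> \<le> rstar + \<epsilon>"
    by (auto simp: eventually_at_top_linorder)
  define T where "T = max \<Theta>bar T1"
  have T: "\<Theta>bar \<le> T" "T1 \<le> T" by (auto simp: T_def)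

  have drift: "norm (b x) \<le> m t"
    if x: "x \<in> spiral_strip r1 r2 {s<..<t}" and s: "\<Theta>bar \<le> s" for x s t
  proof -
    obtain r \<zeta> where x': "x = polar r \<zeta>" "s < \<zeta>" "\<zeta> < t" "r1 \<zeta> < r" "r < r2 \<zeta>"
      using x by (auto simp: spiral_strip_def)
    then have "x \<in> spiral \<theta>0 r1 r2 \<inter> spiral_section r1 r2 \<zeta>"
      using strip_subset_spiral[of s t] x s \<Theta>bar_ge by (auto simp: spiral_section_def)
    then have "norm (b x) \<le> m \<zeta>" using b_le_m x'(2) s by force
    also have "\<dots> \<le> m t" using m_mono x' s by (auto simp: monotone_on_def)
    finally show ?thesis .
  qed
  have drift_bounded: "bounded (b ` spiral_strip r1 r2 {s<..<t})" if s: "\<theta>0 \<le> s" for s t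
  proof -
    obtain B where B: "\<And>x. x \<in> spiral \<theta>0 r1 r2 \<inter> spiral_strip r1 r2 {\<theta>0..\<Theta>bar} \<Longrightarrow> norm (b x) \<le> B"
      using b_bounded by (auto simp: bounded_iff)
    have "norm (b x) \<le> max B (m t)" if x: "x \<in> spiral_strip r1 r2 {s<..<t}" for x
    proof -
      obtain r \<zeta> where x': "x = polar r \<zeta>" "s < \<zeta>" "\<zeta> < t" "r1 \<zeta> < r" "r < r2 \<zeta>"
        using x by (auto simp: spiral_strip_def)
      show ?thesis
      proof (cases "\<zeta> \<le> \<Theta>bar")
        case True
        then have "x \<in> spiral_strip r1 r2 {\<theta>0..\<Theta>bar}"
          using x' s unfolding spiral_strip_def by fastforce
        then show ?thesis using B[of x] strip_subset_spiral[OF s, of t] x by fastforce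
      next
        case False
        then have "x \<in> spiral_strip r1 r2 {\<Theta>bar<..<t}"
          using x' unfolding spiral_strip_def by fastforce
        from drift[OF this] show ?thesis by simp
      qed
    qed
    then show ?thesis by (auto simp: bounded_iff)
  qed
  have contraction: "?M u \<theta> \<le> (1 - c * g (\<theta> + h)) * max (?M u (\<theta> - h)) (?M u (\<theta> + h))"
    if u: "subsolution u" and \<theta>: "T + h \<le> \<theta>" for u \<theta>
    unfolding g_exp
  proof (rule window[OF u])
    show "\<theta>0 \<le> \<theta> - h" using \<theta> T \<Theta>bar_ge by simp
    show "0 \<le> m (\<theta> + h)" using m_nonneg \<theta> T h by simp
    show "\<forall>\<zeta>\<in>{\<theta> - h..\<theta> + h}. rstar - \<epsilon> \<le> r1 \<zeta> \<and> r2 \<zeta> \<le> rstar + \<epsilon>"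
      using T1 \<theta> T by auto
    show "\<forall>x\<in>spiral_strip r1 r2 {\<theta> - h<..<\<theta> + h}. norm (b x) \<le> m (\<theta> + h)"
      using drift \<theta> T by auto
  qed
  have quasi: "?M u t \<le> max (?M u s) (?M u v)"
    if "subsolution u" "\<theta>0 \<le> s" "s \<le> t" "t \<le> v" for u s t v
    using section_max_quasiconvex[OF that(1) drift_bounded that(2-4)] that(2) .

  define \<nu> where "\<nu> = c / h"
  have \<nu>: "0 < \<nu>" using c h by (simp add: \<nu>_def)
  define F where "F \<theta> = integral {\<Theta>bar..\<theta>} g" for \<theta>
  have F_lim: "filterlim F at_top at_top"
    unfolding F_def using \<kappa>_div
    by (intro integral_at_top_of_nn_integral_infinite[OF g_anti g_nonneg]) (simp add: g_def)
  have F_split: "integral {s..\<theta>} g = F \<theta> - F s" if "\<Theta>bar \<le> s" "s \<le> \<theta>" for s \<theta>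
    unfolding F_def using Henstock_Kurzweil_Integration.integral_combine[of \<Theta>bar s \<theta> g] that antimono_on_integrable[OF g_anti, of \<Theta>bar \<theta>]
    by simp
  have g_anti_from: "antimono_on {s..} g" if "\<Theta>bar \<le> s" for s
    using g_anti by (rule monotone_on_subset) (use that in auto)

  let ?\<Theta>0 = "T + 2 * h"
  have decay: "(\<forall>\<theta>\<ge>\<theta>0. ?M u \<theta> \<le> ?M u \<theta>0 *
        (if \<theta> < ?\<Theta>0 then 1 else min 1 (exp (- \<nu> * integral {?\<Theta>0..\<theta>} g))))
      \<and> (?M u \<longlongrightarrow> 0) at_top"
    if u: "subsolution u" and noninc: "antimono_on {\<theta>0..} (?M u)" for u
  proof -
    note nonneg = section_max_bounds(1)[OF u]
    have from0: "?M u \<theta> \<le> ?M u \<theta>0" if "\<theta>0 \<le> \<theta>" for \<theta>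
      using noninc that by (auto simp: monotone_on_def)
    have rate: "?M u \<theta> \<le> ?M u \<theta>0 * exp (- \<nu> * integral {?\<Theta>0..\<theta>} g)" if \<theta>: "?\<Theta>0 \<le> \<theta>" for \<theta>
    proof -
      have "?M u \<theta> \<le> ?M u T * exp (- \<nu> * integral {?\<Theta>0..\<theta>} g)"
        unfolding \<nu>_def
      proof (rule decay_of_contraction[OF h less_imp_le[OF c] g_anti_from[OF T(1)] _ _ _ g_nonneg \<theta>])
        show "antimono_on {T..} (?M u)"
          using noninc by (rule monotone_on_subset) (use T \<Theta>bar_ge in auto)
        show "0 \<le> ?M u t" if "T \<le> t" for t
          using nonneg that T \<Theta>bar_ge by simp
        show "?M u t \<le> (1 - c * g (t + h)) * ?M u (t - h)" if t: "T + h \<le> t" for t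
        proof -
          have "?M u (t + h) \<le> ?M u (t - h)"
            using t h T \<Theta>bar_ge by (intro monotone_onD[OF noninc]) auto
          then show ?thesis using contraction[OF u t] by (simp add: max_def)
        qed
      qed
      also have "\<dots> \<le> ?M u \<theta>0 * exp (- \<nu> * integral {?\<Theta>0..\<theta>} g)"
        using from0[of T] T \<Theta>bar_ge by (intro mult_right_mono) auto
      finally show ?thesis .
    qed
    have "(?M u \<longlongrightarrow> 0) at_top"
    proof (rule tendsto_sandwich[OF _ _ tendsto_const])
      show "\<forall>\<^sub>F \<theta> in at_top. 0 \<le> ?M u \<theta>"
        using eventually_ge_at_top[of \<theta>0] by eventually_elim (rule nonneg)
      show "\<forall>\<^sub>F \<theta> in at_top. ?M u \<theta> \<le> ?M u \<theta>0 * exp (- (\<nu> * (F \<theta> - F ?\<Theta>0)))"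
        using eventually_ge_at_top[of ?\<Theta>0]
      proof eventually_elim
        case (elim \<theta>)
        then show ?case using rate[of \<theta>] F_split[of ?\<Theta>0 \<theta>] T h by simp
      qed
      have "filterlim (\<lambda>\<theta>. \<nu> * (- F ?\<Theta>0 + F \<theta>)) at_top at_top"
        by (intro filterlim_tendsto_pos_mult_at_top[OF tendsto_const \<nu>]
            filterlim_tendsto_add_at_top[OF tendsto_const] F_lim)
      then have "((\<lambda>\<theta>. exp (- (\<nu> * (- F ?\<Theta>0 + F \<theta>)))) \<longlongrightarrow> 0) at_top"
        by (intro filterlim_compose[OF exp_at_bot] filterlim_compose[OF filterlim_uminus_at_bot_at_top])
      from tendsto_mult[OF tendsto_const[of "?M u \<theta>0"] this]
      show "((\<lambda>\<theta>. ?M u \<theta>0 * exp (- (\<nu> * (F \<theta> - F ?\<Theta>0)))) \<longlongrightarrow> 0) at_top"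
        by (simp add: algebra_simps)
    qed
    with rate from0 show ?thesis by (simp add: min_def)
  qed
  have growth: "(\<exists>C>0. \<forall>\<^sub>F \<theta> in at_top. ?M u \<theta> \<ge> C * exp (\<nu> * F \<theta>))
      \<and> filterlim (?M u) at_top at_top"
    if u: "subsolution u" and st: "\<theta>0 \<le> s" "s < t" "?M u s < ?M u t"
      and nondec: "mono_on {t..} (?M u)" for u s t
  proof -
    note nonneg = section_max_bounds(1)[OF u]
    define S where "S = max t T"
    have S: "t \<le> S" "T \<le> S" "\<Theta>bar \<le> S" "\<theta>0 \<le> S" using st T by (auto simp: S_def)
    have nondec_S: "mono_on {S..} (?M u)"
      using nondec by (rule monotone_on_subset) (use S in auto)
    have "?M u t \<le> ?M u S" using S by (intro monotone_onD[OF nondec]) auto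
    then have S_pos: "0 < ?M u S" using nonneg[OF st(1)] st(3) by simp
    define C where "C = ?M u S * exp (- \<nu> * F (S + 2 * h))"
    have C: "0 < C" using S_pos by (simp add: C_def)
    have lower: "C * exp (\<nu> * F \<theta>) \<le> ?M u \<theta>" if \<theta>: "S + 2 * h \<le> \<theta>" for \<theta>
    proof -
      have "C * exp (\<nu> * F \<theta>) = ?M u S * exp (\<nu> * integral {S + 2 * h..\<theta>} g)"
      proof -
        have F_eq: "F \<theta> = F (S + 2 * h) + integral {S + 2 * h..\<theta>} g"
        proof -
          have "integral {S + 2 * h..\<theta>} g = F \<theta> - F (S + 2 * h)"
            by (rule F_split) (use \<theta> S h in auto)
          then show ?thesis by linarith
        qed
        have "- \<nu> * F (S + 2 * h) + \<nu> * F \<theta> = \<nu> * integral {S + 2 * h..\<theta>} g"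
          unfolding F_eq by (simp add: distrib_left)
        then show ?thesis
          by (simp only: C_def mult.assoc exp_add[symmetric])
      qed
      also have "\<dots> \<le> ?M u \<theta>"
        unfolding \<nu>_def
      proof (rule growth_of_contraction[OF h less_imp_le[OF c] g_anti_from[OF S(3)] nondec_S _ _ g_nonneg \<theta>])
        show "0 \<le> ?M u v" if "S \<le> v" for v
          using nonneg that S by simp
        show "?M u v \<le> (1 - c * g (v + h)) * ?M u (v + h)" if v: "S + h \<le> v" for v
        proof -
          have "?M u (v - h) \<le> ?M u (v + h)"
            using v h by (intro monotone_onD[OF nondec_S]) auto
          then show ?thesis using contraction[OF u, of v] v S by (simp add: max_def split: if_splits)
        qed
      qed
      finally show ?thesis .
    qed
    then have ev: "\<forall>\<^sub>F \<theta> in at_top. C * exp (\<nu> * F \<theta>) \<le> ?M u \<theta>"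
      by (auto simp: eventually_at_top_linorder)
    have "filterlim (\<lambda>\<theta>. C * exp (\<nu> * F \<theta>)) at_top at_top"
      by (intro filterlim_tendsto_pos_mult_at_top[OF tendsto_const C]
          filterlim_compose[OF exp_at_top] filterlim_tendsto_pos_mult_at_top[OF tendsto_const \<nu>] F_lim)
    from filterlim_at_top_mono[OF this ev] C ev show ?thesis by blast
  qed

  have "(\<forall>\<theta>\<ge>\<theta>0. ?M u \<theta> \<le> ?M u \<theta>0 *
        (if \<theta> < ?\<Theta>0 then 1 else min 1 (exp (- \<nu> * integral {?\<Theta>0..\<theta>} g))))
      \<and> (?M u \<longlongrightarrow> 0) at_top
    \<or> (\<exists>C>0. \<forall>\<^sub>F \<theta> in at_top. ?M u \<theta> \<ge> C * exp (\<nu> * F \<theta>))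
      \<and> filterlim (?M u) at_top at_top"
    if u: "subsolution u" for u
    using quasi[OF u]
  proof (rule quasiconvex_dichotomy[of \<theta>0 "?M u"])
    assume "antimono_on {\<theta>0..} (?M u)"
    from decay[OF u this] show ?thesis by (rule disjI1)
  next
    fix s t assume "\<theta>0 \<le> s" "s < t" "?M u s < ?M u t" "mono_on {t..} (?M u)"
    from growth[OF u this] show ?thesis by (rule disjI2)
  qed
  note possibilities = this[unfolded F_def g_eq]
  show ?thesis
  proof (rule exI[of _ ?\<Theta>0], rule exI[of _ \<nu>], intro conjI allI impI)
    show "\<Theta>bar \<le> ?\<Theta>0" using T h by simp
    show "0 < \<nu>" by (rule \<nu>)
  qed (rule possibilities, simp add: subsolution_def)
qed

end
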